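(* Let $F:\mathbb{R}^n\times\mathbb{R}^q\to\mathbb{R}$ be of the form $F(x,z)=f(x)+z^\top(Ax-b)$, with $A\in\mathbb{R}^{q\times n}$, $b\in\mathbb{R}^q$, and $f:\mathbb{R}^n\to\mathbb{R}$ strongly convex, twice continuously differentiable, and satisfying $mI\preceq\nabla^2f(x)\preceq MI$ for all $x\in\mathbb{R}^n$ and some constants $0<m\le M<\infty$. Assume the set $\mathrm{Saddle}(F)$ of saddle points of $F$ is non-empty. Then the dynamics $$\begin{bmatrix} \dot x \\ \dot z \end{bmatrix}=\begin{bmatrix} -\nabla_x F(x,z) \\ \nabla_z F(x,z) \end{bmatrix}+\begin{bmatrix} u_x \\ u_z \end{bmatrix},$$ where $(u_x,u_z):\mathbb{R}_{\ge0}\to\mathbb{R}^n\times\mathbb{R}^q$ is a measurable and locally essentially bounded map, is input-to-state stable (ISS) with respect to $\mathrm{Saddle}(F)$.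
   Context: A point $(x_*,z_* )\in\mathbb{R}^n\times\mathbb{R}^q$ is a saddle point of $F$ if $F(x_*,z)\le F(x_*,z_* )\le F(x,z_* )$ for all $x\in\mathbb{R}^n$, $z\in\mathbb{R}^q$. $\mathrm{Saddle}(F)$ coincides with the set of equilibria of the unforced dynamics. $\|\cdot\|$ is the Euclidean norm and $\|w\|_{\mathcal{S}}=\inf_{v\in\mathcal{S}}\|w-v\|$. A function $\alpha:\mathbb{R}_{\ge0}\to\mathbb{R}_{\ge0}$ is class $\mathcal{K}$ if it is continuous, strictly increasing and $\alpha(0)=0$. A function $\beta:\mathbb{R}_{\ge0}\times\mathbb{R}_{\ge0}\to\mathbb{R}_{\ge0}$ is class $\mathcal{KL}$ if $r\mapsto\beta(r,t)$ is class $\mathcal{K}$ for each $t\ge0$ and, for each $r\ge0$, $t\mapsto\beta(r,t)$ is continuous and decreasing with $\beta(r,t)\to0$ as $t\to\infty$. A system $\dot w=h(w,u)$ with set of equilibria of the unforced system $\mathcal{S}$ is ISS with respect to $\mathcal{S}$ if there exist $\beta\in\mathcal{KL}$ and $\gamma\in\mathcal{K}$ such that each trajectory satisfies $\|w(t)\|_{\mathcal{S}}\le\beta(\|w(0)\|_{\mathcal{S}},t)+\gamma(\|u\|_\infty)$ for all $t\ge0$, where $\|u\|_\infty=\operatorname{ess\,sup}_{t\ge0}\|u(t)\|$. *)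

theory Defs
  imports "HOL-Analysis.Analysis" "HOL-Probability.Essential_Supremum"
begin

subsection \<open>Regularity and convexity of the objective\<close>

definition gradient :: "('a::real_inner \<Rightarrow> real) \<Rightarrow> 'a \<Rightarrow> 'a" where
  "gradient f x = (THE D. GDERIV f x :> D)"

lemma gradient_eqI:
  assumes "GDERIV f x :> D"
  shows "gradient f x = D"
  unfolding gradient_def
proof (rule the_equality)
  show "GDERIV f x :> D" by fact
next
  fix E assume "GDERIV f x :> E"
  with assms have "(\<lambda>h. h \<bullet> E) = (\<lambda>h. h \<bullet> D)"
    unfolding gderiv_def by (rule has_derivative_unique[rotated])
  then show "E = D"
    by (metis vector_eq_ldot)
qed

definition hessian :: "(real^'n \<Rightarrow> real) \<Rightarrow> real^'n \<Rightarrow> real^'n^'n" where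
  "hessian f x = jacobian (gradient f) (at x)"

definition twice_continuously_differentiable :: "(real^'n \<Rightarrow> real) \<Rightarrow> bool" where
  "twice_continuously_differentiable f \<longleftrightarrow>
     (\<forall>x. f differentiable (at x)) \<and>
     (\<forall>x. gradient f differentiable (at x)) \<and>
     continuous_on UNIV (hessian f)"

definition strongly_convex :: "('a::real_inner \<Rightarrow> real) \<Rightarrow> bool" where
  "strongly_convex f \<longleftrightarrow>
     (\<exists>\<mu>>0. \<forall>x y. \<forall>t\<in>{0..1}.
        f (t *\<^sub>R x + (1 - t) *\<^sub>R y)
          \<le> t * f x + (1 - t) * f y - \<mu> / 2 * t * (1 - t) * (norm (x - y))\<^sup>2)"

text \<open>
  The Loewner order. Symmetry is not demanded: it is only applied to Hessians of
  twice continuously differentiable functions and to multiples of the identity,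
  all of which are symmetric.
\<close>

definition positive_semidefinite :: "real^'n^'n \<Rightarrow> bool" where
  "positive_semidefinite B \<longleftrightarrow> (\<forall>v. 0 \<le> v \<bullet> (B *v v))"

definition loewner_le :: "real^'n^'n \<Rightarrow> real^'n^'n \<Rightarrow> bool" (infix \<open>\<preceq>\<^sub>L\<close> 50) where
  "B \<preceq>\<^sub>L C \<longleftrightarrow> positive_semidefinite (C - B)"


subsection \<open>Saddle points and saddle-point dynamics\<close>

definition Saddle :: "('a \<Rightarrow> 'b \<Rightarrow> real) \<Rightarrow> ('a \<times> 'b) set" where
  "Saddle F = {(xs, zs). \<forall>x z. F xs z \<le> F xs zs \<and> F xs zs \<le> F x zs}"

definition saddle_dynamics ::
  "('a::real_inner \<Rightarrow> 'b::real_inner \<Rightarrow> real) \<Rightarrow> 'a \<times> 'b \<Rightarrow> 'a \<times> 'b \<Rightarrow> 'a \<times> 'b" where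
  "saddle_dynamics F w u =
     (case w of (x, z) \<Rightarrow> (- gradient (\<lambda>x'. F x' z) x, gradient (\<lambda>z'. F x z') z)) + u"


subsection \<open>Comparison functions\<close>

text \<open>
  Functions on the nonnegative reals are total functions of which only the values at
  nonnegative arguments matter.
\<close>

definition class_K :: "(real \<Rightarrow> real) \<Rightarrow> bool" where
  "class_K \<alpha> \<longleftrightarrow>
     (\<forall>r\<ge>0. 0 \<le> \<alpha> r) \<and> continuous_on {0..} \<alpha> \<and> strict_mono_on {0..} \<alpha> \<and> \<alpha> 0 = 0"

text \<open>
  Decrease in the second argument is non-strict; strict decrease would be
  contradictory, because \<open>\<beta> 0 t = 0\<close> for all \<open>t\<close>.
\<close>

definition class_KL :: "(real \<Rightarrow> real \<Rightarrow> real) \<Rightarrow> bool" where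
  "class_KL \<beta> \<longleftrightarrow>
     (\<forall>t\<ge>0. class_K (\<lambda>r. \<beta> r t)) \<and>
     (\<forall>r\<ge>0. continuous_on {0..} (\<beta> r) \<and> antimono_on {0..} (\<beta> r) \<and> (\<beta> r \<longlongrightarrow> 0) at_top)"


subsection \<open>Inputs and trajectories\<close>

definition admissible_input :: "(real \<Rightarrow> 'u::euclidean_space) \<Rightarrow> bool" where
  "admissible_input u \<longleftrightarrow>
     u \<in> borel_measurable (lebesgue_on {0..}) \<and>
     (\<forall>T\<ge>0. \<exists>C. AE t in lebesgue_on {0..T}. norm (u t) \<le> C)"

definition input_sup_norm :: "(real \<Rightarrow> 'u::euclidean_space) \<Rightarrow> ereal" where
  "input_sup_norm u = esssup (lebesgue_on {0..}) (\<lambda>t. ereal (norm (u t)))"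

text \<open>
  Absolute continuity on \<open>{a..b}\<close>: a pair \<open>(s, t)\<close> in \<open>D\<close> stands for the interval from
  \<open>s\<close> to \<open>t\<close>, and these intervals are non-overlapping.
\<close>

definition absolutely_continuous_between ::
  "real \<Rightarrow> real \<Rightarrow> (real \<Rightarrow> 'w::real_normed_vector) \<Rightarrow> bool" where
  "absolutely_continuous_between a b w \<longleftrightarrow>
     (\<forall>\<epsilon>>0. \<exists>\<delta>>0. \<forall>D. finite D \<and>
        (\<forall>(s, t)\<in>D. a \<le> s \<and> s \<le> t \<and> t \<le> b) \<and>
        pairwise (\<lambda>I J. {fst I<..<snd I} \<inter> {fst J<..<snd J} = {}) D \<and>
        (\<Sum>(s, t)\<in>D. t - s) < \<delta>
        \<longrightarrow> (\<Sum>(s, t)\<in>D. norm (w t - w s)) < \<epsilon>)"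

text \<open>Caratheodory solutions on the nonnegative half-line.\<close>

definition trajectory ::
  "('w::euclidean_space \<Rightarrow> 'u \<Rightarrow> 'w) \<Rightarrow> (real \<Rightarrow> 'u) \<Rightarrow> (real \<Rightarrow> 'w) \<Rightarrow> bool" where
  "trajectory h u w \<longleftrightarrow>
     (\<forall>T\<ge>0. absolutely_continuous_between 0 T w) \<and>
     (AE t in lebesgue_on {0..}. (w has_vector_derivative h (w t) (u t)) (at t within {0..}))"


subsection \<open>Input-to-state stability with respect to the set of equilibria\<close>

definition unforced_equilibria :: "('w \<Rightarrow> 'u::zero \<Rightarrow> 'w::zero) \<Rightarrow> 'w set" where
  "unforced_equilibria h = {w. h w 0 = 0}"

text \<open>
  The estimate is a statement about inputs of finite essential supremum, since \<open>\<gamma>\<close> has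
  no value at infinity.
\<close>

definition ISS_wrt ::
  "('w::euclidean_space \<Rightarrow> 'u::euclidean_space \<Rightarrow> 'w) \<Rightarrow> 'w set \<Rightarrow> bool" where
  "ISS_wrt h S \<longleftrightarrow>
     S = unforced_equilibria h \<and>
     (\<exists>\<beta> \<gamma>. class_KL \<beta> \<and> class_K \<gamma> \<and>
        (\<forall>u w. admissible_input u \<and> trajectory h u w \<and> input_sup_norm u < \<infinity> \<longrightarrow>
           (\<forall>t\<ge>0. infdist (w t) S
                    \<le> \<beta> (infdist (w 0) S) t + \<gamma> (real_of_ereal (input_sup_norm u)))))"

end

theory Submission
  imports Defs
begin

text \<open>
  The idea is a quadratic Lyapunov function. Fix a saddle point \<open>(x\<^sub>0, z\<^sub>0)\<close> and put
  \<open>\<xi> = x - x\<^sub>0\<close>, \<open>\<zeta> = z - z\<^sub>0\<close>. Strong monotonicity of \<open>\<nabla>f\<close> determines \<open>x\<^sub>0\<close> uniquely, whereas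
  \<open>z\<^sub>0\<close> is determined only up to the kernel of \<open>A\<^sup>T\<close>. Hence the saddle set is
  \<open>{x\<^sub>0} \<times> (z\<^sub>0 + ker A\<^sup>T)\<close>, and the squared distance to it is \<open>\<bar>\<xi>\<bar>\<^sup>2 + \<bar>P \<zeta>\<bar>\<^sup>2\<close>, where \<open>P\<close> is the
  orthogonal projection onto the range of \<open>A\<close>. The part of \<open>\<zeta>\<close> in \<open>ker A\<^sup>T\<close> may drift under the
  input, but neither the distance nor the rest of the dynamics sees it.

  Along an unforced trajectory, half the squared distance decreases at the rate
  \<open>\<xi> \<bullet> (\<nabla>f x - \<nabla>f x\<^sub>0) \<ge> m \<bar>\<xi>\<bar>\<^sup>2\<close>, because the coupling terms cancel; this says nothing about
  \<open>\<zeta>\<close>. Adding \<open>\<epsilon> (\<zeta> \<bullet> A \<xi>)\<close> repairs the defect: its derivative contains \<open>- \<epsilon> \<bar>A\<^sup>T \<zeta>\<bar>\<^sup>2\<close>, which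
  is at most a negative multiple of \<open>\<bar>P \<zeta>\<bar>\<^sup>2\<close> since \<open>A\<^sup>T\<close> is injective on the range of \<open>A\<close>, and for small
  \<open>\<epsilon>\<close> the remaining terms are absorbed (\<open>dissipation_estimate\<close>). One of them,
  \<open>A\<^sup>T \<zeta> \<bullet> (\<nabla>f x - \<nabla>f x\<^sub>0)\<close>, needs \<open>\<nabla>f\<close> to be Lipschitz. The Hessian bounds enter as bounds
  on \<open>(\<nabla>f x - \<nabla>f y) \<bullet> (x - y)\<close>, and by the argument of Baillon and Haddad convexity together
  with the quadratic upper bound on \<open>f\<close> forces
  \<open>\<bar>\<nabla>f x - \<nabla>f y\<bar> \<le> M \<bar>x - y\<bar>\<close> (\<open>norm_gradient_diff_le\<close>).

  The outcome is \<open>V' \<le> - \<kappa> V + d \<bar>u\<bar>\<^sup>2\<close> with \<open>V\<close> comparable to the squared distance, and this gives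
  an estimate with exponential \<open>\<beta>\<close> and linear \<open>\<gamma>\<close> (\<open>ISS_wrt_if_quadratic_Lyapunov\<close>). As the
  trajectories are only absolutely continuous, the comparison argument rests on the fact that an
  absolutely continuous function whose derivative is almost everywhere nonpositive does not
  increase (\<open>absolutely_continuous_between_nonincreasing\<close>).
\<close>

section \<open>Absolutely continuous functions and differential inequalities\<close>

text \<open>
  A single domination principle: linear images, sums, Lipschitz images and products of bounded
  functions all inherit absolute continuity from it.
\<close>

lemma absolutely_continuous_between_dominated:
  fixes f :: "real \<Rightarrow> 'x::real_normed_vector" and g :: "real \<Rightarrow> 'y::real_normed_vector"
    and h :: "real \<Rightarrow> 'z::real_normed_vector"
  assumes f: "absolutely_continuous_between a b f" and g: "absolutely_continuous_between a b g"
    and le: "\<And>s t. a \<le> s \<Longrightarrow> s \<le> t \<Longrightarrow> t \<le> b \<Longrightarrow>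
               norm (h t - h s) \<le> K * (norm (f t - f s) + norm (g t - g s))"
  shows "absolutely_continuous_between a b h"
  unfolding absolutely_continuous_between_def
proof (intro allI impI)
  fix e :: real assume "e > 0"
  define e' where "e' = e / (2 * (\<bar>K\<bar> + 1))"
  have e': "e' > 0" using \<open>e > 0\<close> by (simp add: e'_def)
  obtain d1 where d1: "d1 > 0" "\<And>D. finite D \<Longrightarrow>
        (\<forall>(s, t)\<in>D. a \<le> s \<and> s \<le> t \<and> t \<le> b) \<Longrightarrow>
        pairwise (\<lambda>I J. {fst I<..<snd I} \<inter> {fst J<..<snd J} = {}) D \<Longrightarrow>
        (\<Sum>(s, t)\<in>D. t - s) < d1 \<Longrightarrow> (\<Sum>(s, t)\<in>D. norm (f t - f s)) < e'"
    using f e' unfolding absolutely_continuous_between_def by meson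
  obtain d2 where d2: "d2 > 0" "\<And>D. finite D \<Longrightarrow>
        (\<forall>(s, t)\<in>D. a \<le> s \<and> s \<le> t \<and> t \<le> b) \<Longrightarrow>
        pairwise (\<lambda>I J. {fst I<..<snd I} \<inter> {fst J<..<snd J} = {}) D \<Longrightarrow>
        (\<Sum>(s, t)\<in>D. t - s) < d2 \<Longrightarrow> (\<Sum>(s, t)\<in>D. norm (g t - g s)) < e'"
    using g e' unfolding absolutely_continuous_between_def by meson
  show "\<exists>\<delta>>0. \<forall>D. finite D \<and>
        (\<forall>(s, t)\<in>D. a \<le> s \<and> s \<le> t \<and> t \<le> b) \<and>
        pairwise (\<lambda>I J. {fst I<..<snd I} \<inter> {fst J<..<snd J} = {}) D \<and>
        (\<Sum>(s, t)\<in>D. t - s) < \<delta> \<longrightarrow> (\<Sum>(s, t)\<in>D. norm (h t - h s)) < e"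
  proof (intro exI[of _ "min d1 d2"] conjI allI impI)
    show "min d1 d2 > 0" using d1(1) d2(1) by simp
  next
    fix D assume D: "finite D \<and>
        (\<forall>(s, t)\<in>D. a \<le> s \<and> s \<le> t \<and> t \<le> b) \<and>
        pairwise (\<lambda>I J. {fst I<..<snd I} \<inter> {fst J<..<snd J} = {}) D \<and>
        (\<Sum>(s, t)\<in>D. t - s) < min d1 d2"
    have F: "(\<Sum>(s, t)\<in>D. norm (f t - f s)) < e'" using D by (intro d1(2)) auto
    have G: "(\<Sum>(s, t)\<in>D. norm (g t - g s)) < e'" using D by (intro d2(2)) auto
    have "(\<Sum>(s, t)\<in>D. norm (h t - h s))
        \<le> (\<Sum>(s, t)\<in>D. (\<bar>K\<bar> + 1) * (norm (f t - f s) + norm (g t - g s)))"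
    proof (rule sum_mono, clarify)
      fix s t assume "(s, t) \<in> D"
      with D le have "norm (h t - h s) \<le> K * (norm (f t - f s) + norm (g t - g s))" by blast
      also have "\<dots> \<le> (\<bar>K\<bar> + 1) * (norm (f t - f s) + norm (g t - g s))"
        by (intro mult_right_mono) auto
      finally show "norm (h t - h s) \<le> (\<bar>K\<bar> + 1) * (norm (f t - f s) + norm (g t - g s))" .
    qed
    also have "\<dots> = (\<bar>K\<bar> + 1) * ((\<Sum>(s, t)\<in>D. norm (f t - f s)) + (\<Sum>(s, t)\<in>D. norm (g t - g s)))"
      by (simp add: sum_distrib_left sum.distrib[symmetric] split_def)
    also have "\<dots> < (\<bar>K\<bar> + 1) * (e' + e')"
      using F G by (intro mult_strict_left_mono) auto
    also have "\<dots> = e"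
    proof -
      have "\<bar>K\<bar> + 1 \<noteq> 0" by simp
      then show ?thesis by (simp add: e'_def divide_simps)
    qed
    finally show "(\<Sum>(s, t)\<in>D. norm (h t - h s)) < e" .
  qed
qed

lemma absolutely_continuous_between_id: "absolutely_continuous_between a b (\<lambda>t::real. t)"
  unfolding absolutely_continuous_between_def
proof (intro allI impI)
  fix e :: real assume "e > 0"
  have "(\<Sum>(s, t)\<in>D. norm (t - s)) = (\<Sum>(s, t)\<in>D. t - s)"
    if "\<forall>(s, t)\<in>D. a \<le> s \<and> s \<le> t \<and> t \<le> b" for D :: "(real \<times> real) set"
    using that by (intro sum.cong) auto
  with \<open>e > 0\<close> show "\<exists>\<delta>>0. \<forall>D. finite D \<and>
        (\<forall>(s, t)\<in>D. a \<le> s \<and> s \<le> t \<and> t \<le> b) \<and>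
        pairwise (\<lambda>I J. {fst I<..<snd I} \<inter> {fst J<..<snd J} = {}) D \<and>
        (\<Sum>(s, t)\<in>D. t - s) < \<delta> \<longrightarrow> (\<Sum>(s, t)\<in>D. norm (t - s)) < e"
    by (intro exI[of _ e]) auto
qed

text \<open>
  The definition restated for divisions into compact intervals, the form in which absolute
  continuity meets the gauge integral machinery: the intervals of a division have disjoint
  interiors, and their lengths add up to the measure of their union.
\<close>

lemma absolutely_continuous_between_division:
  fixes w :: "real \<Rightarrow> 'w::real_normed_vector"
  assumes "absolutely_continuous_between a b w" "e > 0"
  obtains d where "d > 0"
    and "\<And>\<D>. \<D> division_of \<Union>\<D> \<Longrightarrow> \<Union>\<D> \<subseteq> {a..b} \<Longrightarrow> measure lebesgue (\<Union>\<D>) < d \<Longrightarrow>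
           (\<Sum>K\<in>\<D>. norm (w (Sup K) - w (Inf K))) < e"
proof -
  obtain d where d: "d > 0" "\<And>D. finite D \<Longrightarrow>
        (\<forall>(s, t)\<in>D. a \<le> s \<and> s \<le> t \<and> t \<le> b) \<Longrightarrow>
        pairwise (\<lambda>I J. {fst I<..<snd I} \<inter> {fst J<..<snd J} = {}) D \<Longrightarrow>
        (\<Sum>(s, t)\<in>D. t - s) < d \<Longrightarrow> (\<Sum>(s, t)\<in>D. norm (w t - w s)) < e"
    using assms unfolding absolutely_continuous_between_def by meson
  have "(\<Sum>K\<in>\<D>. norm (w (Sup K) - w (Inf K))) < e"
    if D: "\<D> division_of \<Union>\<D>" and sub: "\<Union>\<D> \<subseteq> {a..b}" and small: "measure lebesgue (\<Union>\<D>) < d"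
    for \<D> :: "real set set"
  proof -
    define ends where "ends = (\<lambda>K::real set. (Inf K, Sup K))"
    have K: "\<exists>s t. K = {s..t} \<and> s \<le> t \<and> a \<le> s \<and> t \<le> b" if KD: "K \<in> \<D>" for K
    proof -
      obtain s t where st: "K = {s..t}" using division_ofD(4)[OF D KD] by auto
      moreover have "K \<noteq> {}" using division_ofD(3)[OF D KD] .
      ultimately have "s \<le> t" by auto
      moreover have "s \<in> {a..b}" "t \<in> {a..b}" using sub KD st \<open>s \<le> t\<close> by (meson UnionI atLeastAtMost_iff order_refl subsetD)+
      ultimately show ?thesis using st by auto
    qed
    have inj: "inj_on ends \<D>"
    proof (rule inj_onI)
      fix K L assume "K \<in> \<D>" "L \<in> \<D>" "ends K = ends L"
      moreover obtain s t s' t' where "K = {s..t}" "L = {s'..t'}" "s \<le> t" "s' \<le> t'"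
        using K \<open>K \<in> \<D>\<close> \<open>L \<in> \<D>\<close> by meson
      ultimately show "K = L" by (simp add: ends_def)
    qed
    have len: "Sup K - Inf K = measure lebesgue K" if KD: "K \<in> \<D>" for K
      using K[OF that] by auto
    have "(\<Sum>(s, t)\<in>ends ` \<D>. norm (w t - w s)) < e"
    proof (rule d(2))
      show "finite (ends ` \<D>)" using D by auto
      show "\<forall>(s, t)\<in>ends ` \<D>. a \<le> s \<and> s \<le> t \<and> t \<le> b"
      proof clarify
        fix s t K assume "(s, t) = ends K" "K \<in> \<D>"
        then show "a \<le> s \<and> s \<le> t \<and> t \<le> b" using K[of K] by (auto simp: ends_def)
      qed
      show "pairwise (\<lambda>I J. {fst I<..<snd I} \<inter> {fst J<..<snd J} = {}) (ends ` \<D>)"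
      proof (rule pairwise_imageI)
        fix K L assume KL: "K \<in> \<D>" "L \<in> \<D>" "K \<noteq> L" "ends K \<noteq> ends L"
        then have "interior K \<inter> interior L = {}" using division_ofD(5)[OF D] by blast
        moreover obtain s t s' t' where "K = {s..t}" "L = {s'..t'}" "s \<le> t" "s' \<le> t'"
          using K KL by meson
        ultimately show "{fst (ends K)<..<snd (ends K)} \<inter> {fst (ends L)<..<snd (ends L)} = {}"
          by (simp add: ends_def)
      qed
      have "(\<Sum>(s, t)\<in>ends ` \<D>. t - s) = (\<Sum>K\<in>\<D>. Sup K - Inf K)"
        by (subst sum.reindex[OF inj]) (simp add: ends_def)
      also have "\<dots> = (\<Sum>K\<in>\<D>. measure lebesgue K)" using len by simp
      also have "\<dots> = measure lebesgue (\<Union>\<D>)" by (rule content_division[OF D])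
      finally show "(\<Sum>(s, t)\<in>ends ` \<D>. t - s) < d" using small by simp
    qed
    then show ?thesis
      by (subst (asm) sum.reindex[OF inj]) (simp add: ends_def)
  qed
  with d(1) that show thesis by blast
qed

lemma derivative_nonpos_imp_le:
  fixes \<phi> :: "real \<Rightarrow> real"
  assumes "(\<phi> has_real_derivative D) (at x within S)" "D \<le> 0" "\<epsilon> > 0"
  obtains r where "r > 0"
    and "\<And>s t. s \<in> S \<Longrightarrow> t \<in> S \<Longrightarrow> s \<le> x \<Longrightarrow> x \<le> t \<Longrightarrow> \<bar>s - x\<bar> < r \<Longrightarrow> \<bar>t - x\<bar> < r \<Longrightarrow>
           \<phi> t - \<phi> s \<le> \<epsilon> * (t - s)"
proof -
  obtain r where r: "r > 0"
    "\<And>y. y \<in> S \<Longrightarrow> norm (y - x) < r \<Longrightarrow> norm (\<phi> y - \<phi> x - D * (y - x)) \<le> \<epsilon> * norm (y - x)"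
    using assms unfolding has_field_derivative_def has_derivative_within_alt by metis
  have "\<phi> t - \<phi> s \<le> \<epsilon> * (t - s)"
    if "s \<in> S" "t \<in> S" "s \<le> x" "x \<le> t" "\<bar>s - x\<bar> < r" "\<bar>t - x\<bar> < r" for s t
  proof -
    have "\<bar>\<phi> s - \<phi> x - D * (s - x)\<bar> \<le> \<epsilon> * (x - s)" "\<bar>\<phi> t - \<phi> x - D * (t - x)\<bar> \<le> \<epsilon> * (t - x)"
      using r(2)[of s] r(2)[of t] that by auto
    moreover have "D * (t - x) \<le> 0" "D * (s - x) \<ge> 0"
      using that assms(2) by (auto simp: mult_le_0_iff zero_le_mult_iff)
    ultimately show ?thesis by (simp add: algebra_simps)
  qed
  with r(1) that show thesis by blast
qed

text \<open>
  Cousin's lemma replaces the Vitali covering argument. Choose a gauge that is governed by the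
  derivative off the exceptional null set, and that traps intervals tagged in the null set inside
  an open set of small measure. In a fine tagged division, the intervals of the first kind
  contribute at most \<open>\<epsilon>\<close> times their length to the increment of \<open>\<phi>\<close>, and those of the second
  kind little by absolute continuity.
\<close>

theorem absolutely_continuous_between_nonincreasing:
  fixes \<phi> :: "real \<Rightarrow> real"
  assumes "a \<le> b" and ac: "absolutely_continuous_between a b \<phi>"
    and AE: "AE t in lebesgue. t \<in> {a..b} \<longrightarrow>
               (\<exists>D\<le>0. (\<phi> has_real_derivative D) (at t within {a..b}))"
  shows "\<phi> b \<le> \<phi> a"
proof (rule field_le_epsilon)
  fix e :: real assume "e > 0"
  define \<epsilon> where "\<epsilon> = e / (2 * (b - a + 1))"
  have \<epsilon>: "\<epsilon> > 0" "\<epsilon> * (b - a) \<le> e / 2"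
    using \<open>e > 0\<close> \<open>a \<le> b\<close> by (auto simp: \<epsilon>_def field_simps)
  obtain N where N: "N \<in> null_sets lebesgue"
    and sub: "{t \<in> space lebesgue. \<not> (t \<in> {a..b} \<longrightarrow>
               (\<exists>D\<le>0. (\<phi> has_real_derivative D) (at t within {a..b})))} \<subseteq> N"
    using AE unfolding eventually_ae_filter by blast
  have deriv: "\<exists>D\<le>0. (\<phi> has_real_derivative D) (at t within {a..b})" if "t \<in> {a..b} - N" for t
    using sub that by auto
  obtain d where d: "d > 0"
    "\<And>\<D>. \<D> division_of \<Union>\<D> \<Longrightarrow> \<Union>\<D> \<subseteq> {a..b} \<Longrightarrow> measure lebesgue (\<Union>\<D>) < d \<Longrightarrow>
           (\<Sum>K\<in>\<D>. norm (\<phi> (Sup K) - \<phi> (Inf K))) < e / 2"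
    using absolutely_continuous_between_division[OF ac half_gt_zero[OF \<open>e > 0\<close>]] by blast
  obtain T where T: "open T" "N \<subseteq> T" "T - N \<in> lmeasurable" "emeasure lebesgue (T - N) < ennreal d"
    using sets_lebesgue_outer_open[OF null_setsD2[OF N] d(1)] by blast
  have emT: "emeasure lebesgue T = emeasure lebesgue (T - N)"
    using emeasure_Diff_null_set[OF N] T(1) by simp
  then have lt: "emeasure lebesgue T < ennreal d" using T(4) by simp
  then have T': "T \<in> lmeasurable"
    using T(1) by (auto simp: fmeasurable_def intro: order.strict_trans)
  then have "measure lebesgue T < d"
    using lt d(1) by (simp add: emeasure_eq_measure2 ennreal_less_iff)
  note T' = T' this
  \<comment> \<open>Off \<open>N\<close> the gauge comes from differentiability, on \<open>N\<close> it keeps the interval inside \<open>T\<close>.\<close>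
  have "\<exists>r>0. (t \<in> N \<longrightarrow> ball t r \<subseteq> T) \<and>
          (t \<in> {a..b} - N \<longrightarrow> (\<forall>u v. u \<in> {a..b} \<longrightarrow> v \<in> {a..b} \<longrightarrow> u \<le> t \<longrightarrow> t \<le> v \<longrightarrow>
              \<bar>u - t\<bar> < r \<longrightarrow> \<bar>v - t\<bar> < r \<longrightarrow> \<phi> v - \<phi> u \<le> \<epsilon> * (v - u)))" for t
  proof (cases "t \<in> N")
    case True
    then show ?thesis using T(1,2) openE by blast
  next
    case False
    show ?thesis
    proof (cases "t \<in> {a..b}")
      case True
      with False deriv obtain D where "D \<le> 0" "(\<phi> has_real_derivative D) (at t within {a..b})"
        by blast
      then obtain r where "r > 0" "\<And>s u. s \<in> {a..b} \<Longrightarrow> u \<in> {a..b} \<Longrightarrow> s \<le> t \<Longrightarrow> t \<le> u \<Longrightarrow>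
          \<bar>s - t\<bar> < r \<Longrightarrow> \<bar>u - t\<bar> < r \<Longrightarrow> \<phi> u - \<phi> s \<le> \<epsilon> * (u - s)"
        using derivative_nonpos_imp_le \<epsilon>(1) by metis
      with False show ?thesis by blast
    qed (use False in \<open>auto intro: exI[of _ 1]\<close>)
  qed
  then obtain r where r: "\<And>t. r t > 0" "\<And>t. t \<in> N \<Longrightarrow> ball t (r t) \<subseteq> T"
    "\<And>t u v. t \<in> {a..b} - N \<Longrightarrow> u \<in> {a..b} \<Longrightarrow> v \<in> {a..b} \<Longrightarrow> u \<le> t \<Longrightarrow> t \<le> v \<Longrightarrow>
        \<bar>u - t\<bar> < r t \<Longrightarrow> \<bar>v - t\<bar> < r t \<Longrightarrow> \<phi> v - \<phi> u \<le> \<epsilon> * (v - u)"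
    by metis
  have "gauge (\<lambda>t. ball t (r t))" using r(1) by (simp add: gauge_def)
  then obtain p where p: "p tagged_division_of {a..b}" "(\<lambda>t. ball t (r t)) fine p"
    using fine_division_exists_real by blast
  have pK: "\<exists>u v. K = {u..v} \<and> u \<le> t \<and> t \<le> v \<and> a \<le> u \<and> v \<le> b \<and> \<bar>u - t\<bar> < r t \<and> \<bar>v - t\<bar> < r t"
    if tK: "(t, K) \<in> p" for t K
  proof -
    obtain u v where uv: "K = {u..v}" using tagged_division_ofD(4)[OF p(1) tK] by auto
    moreover have "t \<in> K" "K \<subseteq> {a..b}" using tagged_division_ofD[OF p(1)] tK by auto
    moreover have "K \<subseteq> ball t (r t)" using p(2) tK by (auto simp: fine_def)
    ultimately have le: "u \<le> t" "t \<le> v" "a \<le> u" "v \<le> b" and "{u..v} \<subseteq> ball t (r t)" by auto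
    then have "u \<in> ball t (r t)" "v \<in> ball t (r t)" by (meson atLeastAtMost_iff order.trans order_refl subsetD)+
    with le show ?thesis using uv by (auto simp: dist_real_def)
  qed
  define q where "q = {(t, K) \<in> p. t \<in> N}"
  have fin: "finite p" using p(1) by auto
  have q: "q \<subseteq> p" by (auto simp: q_def)
  have "q tagged_partial_division_of {a..b}"
    using tagged_partial_division_subset[OF _ q] p(1) tagged_division_of_def by blast
  then have qdiv: "q tagged_division_of \<Union>(snd ` q)"
    by (rule tagged_partial_division_of_Union_self)
  \<comment> \<open>The case distinction makes \<open>osc\<close> vanish on empty intervals, for which \<open>Sup\<close> and \<open>Inf\<close> are
     arbitrary values.\<close>
  define osc where "osc = (\<lambda>K. if K = {} then 0 else norm (\<phi> (Sup K) - \<phi> (Inf K)))"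
  have osc: "osc K = norm (\<phi> (Sup K) - \<phi> (Inf K))" if "(t, K) \<in> q" for t K
    using tagged_division_ofD(2)[OF qdiv that] by (auto simp: osc_def)
  have "(\<Sum>(t, K)\<in>q. norm (\<phi> (Sup K) - \<phi> (Inf K))) = (\<Sum>(t, K)\<in>q. osc K)"
    using osc by (intro sum.cong) auto
  also have "\<dots> = (\<Sum>K\<in>snd ` q. osc K)"
  proof (rule sum.over_tagged_division_lemma[OF qdiv])
    fix u v :: real assume "box u v = {}"
    then have "v \<le> u" by auto
    then show "osc (cbox u v) = 0"
      by (cases "u = v") (auto simp: osc_def)
  qed
  also have "\<dots> = (\<Sum>K\<in>snd ` q. norm (\<phi> (Sup K) - \<phi> (Inf K)))"
    using osc by (intro sum.cong) auto
  also have "\<dots> < e / 2"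
  proof (rule d(2))
    show dv: "snd ` q division_of \<Union>(snd ` q)"
      using division_of_tagged_division[OF qdiv] .
    show "\<Union>(snd ` q) \<subseteq> {a..b}" using q pK by fastforce
    have "\<Union>(snd ` q) \<subseteq> T" using p(2) r(2) by (fastforce simp: q_def fine_def)
    then have "measure lebesgue (\<Union>(snd ` q)) \<le> measure lebesgue T"
      using T'(1) lmeasurable_division[OF dv] by (intro measure_mono_fmeasurable) auto
    then show "measure lebesgue (\<Union>(snd ` q)) < d" using T'(2) by simp
  qed
  finally have null_part: "(\<Sum>(t, K)\<in>q. \<phi> (Sup K) - \<phi> (Inf K)) < e / 2"
    by (rule le_less_trans[rotated]) (auto intro!: sum_mono)
  have "(\<Sum>(t, K)\<in>p - q. \<phi> (Sup K) - \<phi> (Inf K)) \<le> (\<Sum>(t, K)\<in>p - q. \<epsilon> * (Sup K - Inf K))"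
  proof (rule sum_mono, clarify)
    fix t K assume tK: "(t, K) \<in> p" "(t, K) \<notin> q"
    obtain u v where uv: "K = {u..v}" "u \<le> t" "t \<le> v" "a \<le> u" "v \<le> b" "\<bar>u - t\<bar> < r t" "\<bar>v - t\<bar> < r t"
      using pK[OF tK(1)] by blast
    moreover have "t \<notin> N" using tK by (auto simp: q_def)
    ultimately show "\<phi> (Sup K) - \<phi> (Inf K) \<le> \<epsilon> * (Sup K - Inf K)"
      using r(3)[of t u v] by auto
  qed
  also have "\<dots> \<le> (\<Sum>(t, K)\<in>p. \<epsilon> * (Sup K - Inf K))"
    using fin pK \<epsilon>(1) by (intro sum_mono2) fastforce+
  also have "\<dots> = \<epsilon> * (\<Sum>(t, K)\<in>p. Sup K - Inf K)"
    by (simp add: sum_distrib_left split_def)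
  also have "\<dots> = \<epsilon> * (b - a)"
    using additive_tagged_division_1[OF \<open>a \<le> b\<close> p(1), of "\<lambda>x. x"] by simp
  finally have "(\<Sum>(t, K)\<in>p - q. \<phi> (Sup K) - \<phi> (Inf K)) \<le> e / 2" using \<epsilon>(2) by simp
  moreover have "\<phi> b - \<phi> a = (\<Sum>(t, K)\<in>p. \<phi> (Sup K) - \<phi> (Inf K))"
    using additive_tagged_division_1[OF \<open>a \<le> b\<close> p(1), of \<phi>] by simp
  moreover have "\<dots> = (\<Sum>(t, K)\<in>p - q. \<phi> (Sup K) - \<phi> (Inf K)) + (\<Sum>(t, K)\<in>q. \<phi> (Sup K) - \<phi> (Inf K))"
    using sum.subset_diff[OF q fin] .
  ultimately show "\<phi> b \<le> \<phi> a + e" using null_part by linarith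
qed

lemma absolutely_continuous_between_imp_continuous_on:
  fixes w :: "real \<Rightarrow> 'w::real_normed_vector"
  assumes "absolutely_continuous_between a b w"
  shows "continuous_on {a..b} w"
  unfolding continuous_on_iff
proof (intro ballI allI impI)
  fix x e :: real assume x: "x \<in> {a..b}" and "e > 0"
  obtain d where d: "d > 0" "\<And>D. finite D \<Longrightarrow>
        (\<forall>(s, t)\<in>D. a \<le> s \<and> s \<le> t \<and> t \<le> b) \<Longrightarrow>
        pairwise (\<lambda>I J. {fst I<..<snd I} \<inter> {fst J<..<snd J} = {}) D \<Longrightarrow>
        (\<Sum>(s, t)\<in>D. t - s) < d \<Longrightarrow> (\<Sum>(s, t)\<in>D. norm (w t - w s)) < e"
    using assms \<open>e > 0\<close> unfolding absolutely_continuous_between_def by meson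
  have close: "norm (w t - w s) < e" if "a \<le> s" "s \<le> t" "t \<le> b" "t - s < d" for s t
    using d(2)[of "{(s, t)}"] that by simp
  have "dist (w y) (w x) < e" if "y \<in> {a..b}" "dist y x < d" for y
    using that x close[of x y] close[of y x]
    by (cases y x rule: linorder_le_cases) (auto simp: dist_norm norm_minus_commute)
  then show "\<exists>d>0. \<forall>x'\<in>{a..b}. dist x' x < d \<longrightarrow> dist (w x') (w x) < e"
    using d(1) by blast
qed

lemma absolutely_continuous_between_bilinear:
  fixes f :: "real \<Rightarrow> 'x::real_normed_vector" and g :: "real \<Rightarrow> 'y::real_normed_vector"
    and prod :: "'x \<Rightarrow> 'y \<Rightarrow> 'z::real_normed_vector"
  assumes prod: "bounded_bilinear prod"
    and f: "absolutely_continuous_between a b f" and g: "absolutely_continuous_between a b g"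
  shows "absolutely_continuous_between a b (\<lambda>t. prod (f t) (g t))"
proof -
  interpret bounded_bilinear prod by fact
  have bdd: "\<exists>C\<ge>0. \<forall>t\<in>{a..b}. norm (h t) \<le> C"
    if "absolutely_continuous_between a b h" for h :: "real \<Rightarrow> 'v::real_normed_vector"
  proof -
    have "compact (h ` {a..b})"
      using absolutely_continuous_between_imp_continuous_on[OF that] by (intro compact_continuous_image) auto
    then obtain C where "C > 0" "\<forall>y\<in>h ` {a..b}. norm y \<le> C"
      using compact_imp_bounded bounded_pos by blast
    then show ?thesis by (intro exI[of _ C]) auto
  qed
  obtain Cf where Cf: "Cf \<ge> 0" "\<forall>t\<in>{a..b}. norm (f t) \<le> Cf" using bdd[OF f] by blast
  obtain Cg where Cg: "Cg \<ge> 0" "\<forall>t\<in>{a..b}. norm (g t) \<le> Cg" using bdd[OF g] by blast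
  obtain K where K: "K \<ge> 0" "\<And>x y. norm (prod x y) \<le> norm x * norm y * K"
    using nonneg_bounded by blast
  show ?thesis
  proof (rule absolutely_continuous_between_dominated[OF f g, where K = "(Cf + Cg) * K"])
    fix s t assume st: "a \<le> s" "s \<le> t" "t \<le> b"
    have "prod (f t) (g t) - prod (f s) (g s) = prod (f t) (g t - g s) + prod (f t - f s) (g s)"
      by (simp add: diff_left diff_right)
    also have "norm \<dots> \<le> norm (f t) * norm (g t - g s) * K + norm (f t - f s) * norm (g s) * K"
      by (intro norm_triangle_mono K)
    also have "\<dots> \<le> (Cf + Cg) * norm (g t - g s) * K + norm (f t - f s) * (Cf + Cg) * K"
      using st Cf Cg K(1) by (intro add_mono mult_right_mono mult_left_mono) (auto intro: add_increasing add_increasing2)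
    finally show "norm (prod (f t) (g t) - prod (f s) (g s))
        \<le> (Cf + Cg) * K * (norm (f t - f s) + norm (g t - g s))"
      by (simp add: algebra_simps)
  qed
qed

lemma absolutely_continuous_between_exp: "absolutely_continuous_between a b (\<lambda>t. exp (\<kappa> * t))"
proof -
  obtain C where C: "\<And>t. t \<in> {a..b} \<Longrightarrow> \<bar>exp (\<kappa> * t) * \<kappa>\<bar> \<le> C"
  proof -
    have "compact ((\<lambda>t. exp (\<kappa> * t) * \<kappa>) ` {a..b})"
      by (intro compact_continuous_image continuous_intros) auto
    then obtain C where "\<forall>y\<in>(\<lambda>t. exp (\<kappa> * t) * \<kappa>) ` {a..b}. norm y \<le> C"
      using compact_imp_bounded bounded_iff by blast
    then show thesis using that[of C] by auto
  qed
  show ?thesis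
  proof (rule absolutely_continuous_between_dominated
      [OF absolutely_continuous_between_id absolutely_continuous_between_id, where K = C])
    fix s t assume st: "a \<le> s" "s \<le> t" "t \<le> b"
    have "norm (exp (\<kappa> * t) - exp (\<kappa> * s)) \<le> C * norm (t - s)"
    proof (rule field_differentiable_bound[where S = "{a..b}" and f' = "\<lambda>t. exp (\<kappa> * t) * \<kappa>"])
      show "((\<lambda>t. exp (\<kappa> * t)) has_field_derivative exp (\<kappa> * z) * \<kappa>) (at z within {a..b})" for z
        by (auto intro!: derivative_eq_intros)
    qed (use st C in auto)
    moreover have "0 \<le> C" using C[of s] st by auto
    ultimately show "norm (exp (\<kappa> * t) - exp (\<kappa> * s)) \<le> C * (norm (t - s) + norm (t - s))"
      by (smt (verit) mult_left_mono norm_ge_zero)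
  qed
qed

text \<open>
  Gronwall's argument: the integrating factor turns the differential inequality into
  monotonicity of \<open>exp (\<kappa> t) (V t - c / \<kappa>)\<close>.
\<close>

theorem absolutely_continuous_between_exponential_decay:
  fixes V :: "real \<Rightarrow> real"
  assumes "0 \<le> T" and V: "absolutely_continuous_between 0 T V" and "\<kappa> > 0" and "0 \<le> c"
    and AE: "AE t in lebesgue. t \<in> {0..T} \<longrightarrow>
               (\<exists>D. D \<le> - \<kappa> * V t + c \<and> (V has_real_derivative D) (at t within {0..T}))"
  shows "V T \<le> exp (- \<kappa> * T) * V 0 + c / \<kappa>"
proof -
  define \<phi> where "\<phi> = (\<lambda>t. exp (\<kappa> * t) * (V t - c / \<kappa>))"
  have "absolutely_continuous_between 0 T (\<lambda>t. V t - c / \<kappa>)"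
    by (rule absolutely_continuous_between_dominated[OF V V, where K = 1]) auto
  then have ac: "absolutely_continuous_between 0 T \<phi>"
    unfolding \<phi>_def
    by (intro absolutely_continuous_between_bilinear[OF bounded_bilinear_mult]
        absolutely_continuous_between_exp)
  have "\<phi> T \<le> \<phi> 0"
  proof (rule absolutely_continuous_between_nonincreasing[OF \<open>0 \<le> T\<close> ac])
    show "AE t in lebesgue. t \<in> {0..T} \<longrightarrow>
            (\<exists>D\<le>0. (\<phi> has_real_derivative D) (at t within {0..T}))"
      using AE
    proof (eventually_elim, intro impI)
      fix t assume "t \<in> {0..T} \<longrightarrow>
        (\<exists>D. D \<le> - \<kappa> * V t + c \<and> (V has_real_derivative D) (at t within {0..T}))" "t \<in> {0..T}"
      then obtain D where D: "D \<le> - \<kappa> * V t + c" "(V has_real_derivative D) (at t within {0..T})"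
        by blast
      have "(\<phi> has_real_derivative exp (\<kappa> * t) * (D + \<kappa> * V t - c)) (at t within {0..T})"
        unfolding \<phi>_def using D(2) \<open>\<kappa> > 0\<close>
        by (auto intro!: derivative_eq_intros simp: field_simps)
      moreover have "exp (\<kappa> * t) * (D + \<kappa> * V t - c) \<le> 0"
        using D(1) by (intro mult_nonneg_nonpos) auto
      ultimately show "\<exists>D\<le>0. (\<phi> has_real_derivative D) (at t within {0..T})" by blast
    qed
  qed
  then have "exp (- \<kappa> * T) * (exp (\<kappa> * T) * (V T - c / \<kappa>)) \<le> exp (- \<kappa> * T) * (V 0 - c / \<kappa>)"
    by (intro mult_left_mono) (auto simp: \<phi>_def)
  then have "V T - c / \<kappa> \<le> exp (- \<kappa> * T) * (V 0 - c / \<kappa>)"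
    by (simp add: mult.assoc[symmetric] exp_add[symmetric])
  also have "\<dots> \<le> exp (- \<kappa> * T) * V 0"
    using assms by (intro mult_left_mono) auto
  finally show ?thesis by simp
qed

section \<open>Quadratic Lyapunov functions\<close>

lemma input_sup_norm_nonneg: "0 \<le> input_sup_norm u"
proof -
  have "emeasure lebesgue {0..1::real} \<le> emeasure lebesgue {0::real..}"
    by (intro emeasure_mono) auto
  then have "emeasure (lebesgue_on {0::real..}) (space (lebesgue_on {0..})) \<noteq> 0"
    by (auto simp: emeasure_restrict_space)
  then have "0 = esssup (lebesgue_on {0::real..}) (\<lambda>t. 0 :: ereal)"
    by (simp add: esssup_const)
  also have "\<dots> \<le> input_sup_norm u"
    unfolding input_sup_norm_def by (intro esssup_mono) auto
  finally show ?thesis .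
qed

lemma AE_norm_le_input_sup_norm:
  assumes "input_sup_norm u < \<infinity>"
  shows "AE t in lebesgue_on {0..}. norm (u t) \<le> real_of_ereal (input_sup_norm u)"
proof -
  have "input_sup_norm u = ereal (real_of_ereal (input_sup_norm u))"
    using assms input_sup_norm_nonneg[of u] by (simp add: ereal_real)
  moreover have "AE t in lebesgue_on {0..}. ereal (norm (u t)) \<le> input_sup_norm u"
    unfolding input_sup_norm_def by (rule esssup_AE)
  ultimately show ?thesis by (metis (no_types, lifting) ereal_less_eq(3) eventually_mono)
qed

text \<open>
  The Lyapunov function is the quadratic form of \<open>B\<close> centred at \<open>e\<close>. The hypothesis \<open>decay\<close> bounds
  its derivative along the vector field, which is expanded by the product rule. Taking square
  roots in the resulting bound on the squared distance gives an exponential \<open>\<beta>\<close> and a linear \<open>\<gamma>\<close>.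
\<close>

theorem ISS_wrt_if_quadratic_Lyapunov:
  fixes h :: "'w::euclidean_space \<Rightarrow> 'u::euclidean_space \<Rightarrow> 'w"
    and B :: "'w \<Rightarrow> 'w \<Rightarrow> real"
  assumes S: "S = unforced_equilibria h" and B: "bounded_bilinear B"
    and pos: "\<kappa> > 0" "c > 0" "C > 0" "d > 0"
    and lower: "\<And>w. c * (infdist w S)\<^sup>2 \<le> B (w - e) (w - e)"
    and upper: "\<And>w. B (w - e) (w - e) \<le> C * (infdist w S)\<^sup>2"
    and decay: "\<And>w v. B (w - e) (h w v) + B (h w v) (w - e)
                  \<le> - \<kappa> * B (w - e) (w - e) + d * (norm v)\<^sup>2"
  shows "ISS_wrt h S"
proof -
  define \<beta> where "\<beta> = (\<lambda>r t. sqrt (C / c) * r * exp (- (\<kappa> / 2) * t))"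
  define \<gamma> where "\<gamma> = (\<lambda>r. sqrt (d / (\<kappa> * c)) * r)"
  have "class_K \<gamma>"
    using pos by (auto simp: class_K_def \<gamma>_def strict_mono_on_def intro!: continuous_intros)
  moreover have "class_KL \<beta>"
    unfolding class_KL_def
  proof (intro conjI allI impI)
    fix t :: real
    show "class_K (\<lambda>r. \<beta> r t)"
      using pos by (auto simp: class_K_def \<beta>_def strict_mono_on_def intro!: continuous_intros)
  next
    fix r :: real assume "0 \<le> r"
    show "continuous_on {0..} (\<beta> r)" unfolding \<beta>_def by (intro continuous_intros)
    show "antimono_on {0..} (\<beta> r)"
      using pos \<open>0 \<le> r\<close> by (auto simp: \<beta>_def monotone_on_def intro!: mult_left_mono)
    have "((\<lambda>t. exp (- (\<kappa> / 2) * t)) \<longlongrightarrow> 0) at_top"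
      using pos by (intro filterlim_compose[OF exp_at_bot]
          filterlim_tendsto_neg_mult_at_bot[OF tendsto_const _ filterlim_ident]) auto
    then show "(\<beta> r \<longlongrightarrow> 0) at_top" unfolding \<beta>_def by (rule tendsto_mult_right_zero)
  qed
  moreover have "infdist (w T) S \<le> \<beta> (infdist (w 0) S) T + \<gamma> (real_of_ereal (input_sup_norm u))"
    if traj: "trajectory h u w" and fin: "input_sup_norm u < \<infinity>" and "T \<ge> 0" for u w T
  proof -
    define U where "U = real_of_ereal (input_sup_norm u)"
    have "U \<ge> 0" using input_sup_norm_nonneg[of u] by (simp add: U_def real_of_ereal_pos)
    define V where "V = (\<lambda>t. B (w t - e) (w t - e))"
    have w: "absolutely_continuous_between 0 T w"
      using traj \<open>T \<ge> 0\<close> by (auto simp: trajectory_def)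
    have "absolutely_continuous_between 0 T (\<lambda>t. w t - e)"
      by (rule absolutely_continuous_between_dominated[OF w w, where K = 1]) auto
    then have ac: "absolutely_continuous_between 0 T V"
      unfolding V_def by (intro absolutely_continuous_between_bilinear[OF B])
    have "AE t in lebesgue_on {0..}. norm (u t) \<le> U \<and>
            (w has_vector_derivative h (w t) (u t)) (at t within {0..})"
      using AE_norm_le_input_sup_norm[OF fin] traj by (simp add: trajectory_def U_def)
    then have "AE t in lebesgue. t \<in> {0..} \<longrightarrow> norm (u t) \<le> U \<and>
            (w has_vector_derivative h (w t) (u t)) (at t within {0..})"
      by (subst (asm) AE_restrict_space_iff) auto
    then have "AE t in lebesgue. t \<in> {0..T} \<longrightarrow>
        (\<exists>D. D \<le> - \<kappa> * V t + d * U\<^sup>2 \<and> (V has_real_derivative D) (at t within {0..T}))"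
    proof (eventually_elim, intro impI)
      fix t assume "t \<in> {0..} \<longrightarrow> norm (u t) \<le> U \<and>
            (w has_vector_derivative h (w t) (u t)) (at t within {0..})" "t \<in> {0..T}"
      then have t: "norm (u t) \<le> U" "(w has_vector_derivative h (w t) (u t)) (at t within {0..T})"
        by (auto intro: has_vector_derivative_within_subset)
      let ?D = "B (w t - e) (h (w t) (u t)) + B (h (w t) (u t)) (w t - e)"
      have "((\<lambda>t. w t - e) has_vector_derivative h (w t) (u t)) (at t within {0..T})"
        using t(2) by (auto intro!: derivative_eq_intros)
      then have "(V has_real_derivative ?D) (at t within {0..T})"
        unfolding V_def has_real_derivative_iff_has_vector_derivative
        by (intro bounded_bilinear.has_vector_derivative[OF B])
      moreover have "?D \<le> - \<kappa> * V t + d * U\<^sup>2"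
      proof -
        have "d * (norm (u t))\<^sup>2 \<le> d * U\<^sup>2"
          using t(1) pos by (intro mult_left_mono power_mono) auto
        then show ?thesis unfolding V_def using decay[of "w t" "u t"] by linarith
      qed
      ultimately show "\<exists>D. D \<le> - \<kappa> * V t + d * U\<^sup>2 \<and> (V has_real_derivative D) (at t within {0..T})"
        by blast
    qed
    then have "V T \<le> exp (- \<kappa> * T) * V 0 + d * U\<^sup>2 / \<kappa>"
      using pos by (intro absolutely_continuous_between_exponential_decay[OF \<open>T \<ge> 0\<close> ac]) auto
    also have "\<dots> \<le> exp (- \<kappa> * T) * (C * (infdist (w 0) S)\<^sup>2) + d * U\<^sup>2 / \<kappa>"
      using upper by (auto simp: V_def intro!: mult_left_mono)
    finally have "c * (infdist (w T) S)\<^sup>2 \<le> exp (- \<kappa> * T) * (C * (infdist (w 0) S)\<^sup>2) + d * U\<^sup>2 / \<kappa>"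
      using lower[of "w T"] by (simp add: V_def)
    then have "(infdist (w T) S)\<^sup>2 \<le> C / c * (infdist (w 0) S)\<^sup>2 * exp (- \<kappa> * T) + d / (\<kappa> * c) * U\<^sup>2"
      using pos by (simp add: field_simps)
    also have "\<dots> = (\<beta> (infdist (w 0) S) T)\<^sup>2 + (\<gamma> U)\<^sup>2"
      using pos by (simp add: \<beta>_def \<gamma>_def power_mult_distrib exp_double[symmetric])
    also have "\<dots> \<le> (\<beta> (infdist (w 0) S) T + \<gamma> U)\<^sup>2"
      using pos \<open>U \<ge> 0\<close> by (simp add: power2_sum \<beta>_def \<gamma>_def infdist_nonneg)
    finally show ?thesis
      unfolding U_def[symmetric]
      by (rule power2_le_imp_le) (use pos \<open>U \<ge> 0\<close> in \<open>simp add: \<beta>_def \<gamma>_def infdist_nonneg\<close>)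
  qed
  ultimately show ?thesis unfolding ISS_wrt_def using S by blast
qed

section \<open>Functions with monotone gradient\<close>

text \<open>
  The mean value theorem on the segment from \<open>y\<close> to \<open>x\<close>, with the constant \<open>c\<close> of either sign: a
  negative one, applied to \<open>- G\<close>, yields upper bounds.
\<close>

lemma strongly_monotone_if_derivative_ge:
  fixes G :: "'a::real_inner \<Rightarrow> 'a"
  assumes G: "\<And>x. (G has_derivative H x) (at x)"
    and H: "\<And>x h. c * (norm h)\<^sup>2 \<le> h \<bullet> H x h"
  shows "c * (norm (x - y))\<^sup>2 \<le> (G x - G y) \<bullet> (x - y)"
proof -
  define h where "h = x - y"
  have "G (y + 0 *\<^sub>R h) \<bullet> h - c * 0 * (norm h)\<^sup>2 \<le> G (y + 1 *\<^sub>R h) \<bullet> h - c * 1 * (norm h)\<^sup>2"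
  proof (rule DERIV_nonneg_imp_nondecreasing[of "0::real" 1 "\<lambda>t. G (y + t *\<^sub>R h) \<bullet> h - c * t * (norm h)\<^sup>2"])
    fix t :: real
    have "((\<lambda>t. G (y + t *\<^sub>R h)) has_derivative (\<lambda>s. H (y + t *\<^sub>R h) (s *\<^sub>R h))) (at t)"
      by (rule has_derivative_compose[OF _ G, of "\<lambda>t. y + t *\<^sub>R h"]) (auto intro!: derivative_eq_intros)
    then have "((\<lambda>t. G (y + t *\<^sub>R h)) has_vector_derivative H (y + t *\<^sub>R h) h) (at t)"
      unfolding has_vector_derivative_def
      by (simp add: linear_cmul[OF has_derivative_linear[OF G]])
    then have "((\<lambda>t. G (y + t *\<^sub>R h) \<bullet> h) has_real_derivative H (y + t *\<^sub>R h) h \<bullet> h) (at t)"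
      unfolding has_real_derivative_iff_has_vector_derivative
      by (rule bounded_linear.has_vector_derivative[OF bounded_linear_inner_left])
    then have "((\<lambda>t. G (y + t *\<^sub>R h) \<bullet> h - c * t * (norm h)\<^sup>2) has_real_derivative
        H (y + t *\<^sub>R h) h \<bullet> h - c * (norm h)\<^sup>2) (at t)"
      by (auto intro!: derivative_eq_intros)
    then show "\<exists>D. ((\<lambda>t. G (y + t *\<^sub>R h) \<bullet> h - c * t * (norm h)\<^sup>2) has_real_derivative D) (at t) \<and> 0 \<le> D"
      using H[of h "y + t *\<^sub>R h"] by (auto simp: inner_commute)
  qed simp
  then show ?thesis by (simp add: h_def inner_diff_left)
qed

text \<open>
  A monotone gradient makes the gap between \<open>f\<close> and its tangent nondecreasing along rays.
\<close>

lemma gradient_inequality: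
  fixes f :: "'a::real_inner \<Rightarrow> real"
  assumes f: "\<And>x. GDERIV f x :> G x"
    and mono: "\<And>x y. 0 \<le> (G x - G y) \<bullet> (x - y)"
  shows "f x + G x \<bullet> (y - x) \<le> f y"
proof -
  define h where "h = y - x"
  have "f (x + 0 *\<^sub>R h) - 0 * (G x \<bullet> h) \<le> f (x + 1 *\<^sub>R h) - 1 * (G x \<bullet> h)"
  proof (rule DERIV_nonneg_imp_nondecreasing[of "0::real" 1 "\<lambda>t. f (x + t *\<^sub>R h) - t * (G x \<bullet> h)"])
    fix t :: real assume t: "0 \<le> t"
    have "((\<lambda>t. f (x + t *\<^sub>R h)) has_derivative (\<lambda>s. (s *\<^sub>R h) \<bullet> G (x + t *\<^sub>R h))) (at t)"
      by (rule has_derivative_compose[OF _ f[unfolded gderiv_def], of "\<lambda>t. x + t *\<^sub>R h"])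
        (auto intro!: derivative_eq_intros)
    then have "((\<lambda>t. f (x + t *\<^sub>R h)) has_real_derivative h \<bullet> G (x + t *\<^sub>R h)) (at t)"
      unfolding has_field_derivative_def by (simp add: mult_commute_abs)
    then have "((\<lambda>t. f (x + t *\<^sub>R h) - t * (G x \<bullet> h)) has_real_derivative
        h \<bullet> G (x + t *\<^sub>R h) - G x \<bullet> h) (at t)"
      by (auto intro!: derivative_eq_intros)
    moreover have "0 \<le> h \<bullet> G (x + t *\<^sub>R h) - G x \<bullet> h"
    proof (cases "t = 0")
      case False
      have "0 \<le> t * ((G (x + t *\<^sub>R h) - G x) \<bullet> h)" using mono[of "x + t *\<^sub>R h" x] by simp
      with False t show ?thesis
        by (simp add: zero_le_mult_iff inner_diff_left inner_diff_right inner_commute[of h])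
    qed (simp add: inner_commute)
    ultimately show "\<exists>D. ((\<lambda>t. f (x + t *\<^sub>R h) - t * (G x \<bullet> h)) has_real_derivative D) (at t) \<and> 0 \<le> D"
      by blast
  qed simp
  then show ?thesis by (simp add: h_def)
qed

text \<open>
  This is the gradient inequality for the function \<open>x \<mapsto> M / 2 * \<bar>x\<bar>\<^sup>2 - f x\<close>, whose gradient is
  monotone.
\<close>

lemma descent_inequality:
  fixes f :: "'a::real_inner \<Rightarrow> real"
  assumes f: "\<And>x. GDERIV f x :> G x"
    and le: "\<And>x y. (G x - G y) \<bullet> (x - y) \<le> M * (norm (x - y))\<^sup>2"
  shows "f y \<le> f x + G x \<bullet> (y - x) + M / 2 * (norm (y - x))\<^sup>2"
proof -
  have "GDERIV (\<lambda>x. M / 2 * (x \<bullet> x) - f x) x :> M *\<^sub>R x - G x" for x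
    using f[of x] unfolding gderiv_def
    by (auto intro!: derivative_eq_intros simp: inner_diff_right inner_commute)
  then have "M / 2 * (x \<bullet> x) - f x + (M *\<^sub>R x - G x) \<bullet> (y - x) \<le> M / 2 * (y \<bullet> y) - f y"
  proof (rule gradient_inequality)
    fix x y
    have "(M *\<^sub>R x - G x - (M *\<^sub>R y - G y)) \<bullet> (x - y) = M * (norm (x - y))\<^sup>2 - (G x - G y) \<bullet> (x - y)"
      by (simp add: power2_norm_eq_inner inner_diff_left inner_diff_right algebra_simps)
    with le[of x y] show "0 \<le> (M *\<^sub>R x - G x - (M *\<^sub>R y - G y)) \<bullet> (x - y)" by simp
  qed
  moreover have "M / 2 * (norm (y - x))\<^sup>2 = M / 2 * (y \<bullet> y) - M / 2 * (x \<bullet> x) - M *\<^sub>R x \<bullet> (y - x)"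
    by (simp add: power2_norm_eq_inner inner_diff_left inner_diff_right inner_commute field_simps)
  ultimately show ?thesis unfolding inner_diff_left by linarith
qed

text \<open>
  The argument of Baillon and Haddad. Subtracting the tangent of \<open>f\<close> at \<open>y\<close> leaves a function that
  is minimal at \<open>y\<close>; the gradient step of size \<open>1 / M\<close> from \<open>x\<close> lowers it by at least
  \<open>\<bar>G x - G y\<bar>\<^sup>2 / (2 M)\<close>, while its value at \<open>x\<close> exceeds the minimum by at most \<open>M / 2 * \<bar>x - y\<bar>\<^sup>2\<close>.
\<close>

lemma norm_gradient_diff_le:
  fixes f :: "'a::real_inner \<Rightarrow> real"
  assumes f: "\<And>x. GDERIV f x :> G x"
    and mono: "\<And>x y. 0 \<le> (G x - G y) \<bullet> (x - y)"
    and le: "\<And>x y. (G x - G y) \<bullet> (x - y) \<le> M * (norm (x - y))\<^sup>2"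
    and "M > 0"
  shows "norm (G x - G y) \<le> M * norm (x - y)"
proof -
  define D where "D = G x - G y"
  \<comment> \<open>the gradient step from \<open>x\<close> for \<open>f\<close> minus its tangent at \<open>y\<close>\<close>
  define z where "z = x - (1 / M) *\<^sub>R D"
  have "f y + G y \<bullet> (z - y) \<le> f z" by (rule gradient_inequality[OF f mono])
  also have "\<dots> \<le> f x + G x \<bullet> (z - x) + M / 2 * (norm (z - x))\<^sup>2" by (rule descent_inequality[OF f le])
  also have "f x \<le> f y + G y \<bullet> (x - y) + M / 2 * (norm (x - y))\<^sup>2" by (rule descent_inequality[OF f le])
  finally have "0 \<le> M / 2 * (norm (x - y))\<^sup>2 + D \<bullet> (z - x) + M / 2 * (norm (z - x))\<^sup>2"
    by (simp add: D_def inner_diff_left inner_diff_right algebra_simps)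
  also have "D \<bullet> (z - x) = - (norm D)\<^sup>2 / M" by (simp add: z_def power2_norm_eq_inner)
  also have "M / 2 * (norm (z - x))\<^sup>2 = (norm D)\<^sup>2 / (2 * M)"
    using \<open>M > 0\<close> by (simp add: z_def power_divide field_simps power2_eq_square)
  finally have "(norm D)\<^sup>2 \<le> (M * norm (x - y))\<^sup>2"
    using \<open>M > 0\<close> by (simp add: field_simps power2_eq_square)
  then show ?thesis unfolding D_def
    by (rule power2_le_imp_le) (use \<open>M > 0\<close> in simp)
qed

section \<open>Orthogonal projection onto the range of a matrix\<close>

lemma orthogonal_projection_exists:
  fixes S :: "'a::euclidean_space set"
  assumes "subspace S"
  obtains P where "linear P" "\<And>y z. P y \<bullet> z = y \<bullet> P z" "\<And>y. P y \<in> S" "\<And>y. y \<in> S \<Longrightarrow> P y = y"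
proof -
  obtain B where B: "B \<subseteq> S" "pairwise orthogonal B" "\<And>x. x \<in> B \<Longrightarrow> norm x = 1" "independent B"
    "card B = dim S" "span B = S"
    using orthonormal_basis_subspace[OF assms] by metis
  have fin: "finite B" using B(4) by (rule independent_imp_finite)
  define P where "P = (\<lambda>y. \<Sum>e\<in>B. (e \<bullet> y) *\<^sub>R e)"
  show thesis
  proof (rule that[of P])
    show "linear P"
      unfolding P_def by (rule linearI) (simp_all add: inner_add_right scaleR_add_left sum.distrib scaleR_sum_right)
    show "P y \<bullet> z = y \<bullet> P z" for y z
      by (simp add: P_def inner_sum_left inner_sum_right inner_commute mult.commute)
    show "P y \<in> S" for y
      unfolding P_def using B(1) assms by (intro subspace_sum subspace_scale) auto
    show "P y = y" if "y \<in> S" for y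
      unfolding P_def using orthonormal_basis_expand[OF B(2,3) _ fin] that B(6)
      by (subst inner_commute) simp
  qed
qed

lemma transpose_inner: "(transpose A *v z) \<bullet> x = z \<bullet> (A *v x)" for A :: "real^'n^'q"
  by (simp add: dot_lmul_matrix[symmetric])

text \<open>
  The range of \<open>A\<close> and the kernel of \<open>A\<^sup>T\<close> are orthogonal complements, so the projection onto the
  former does not change \<open>A\<^sup>T z\<close> and annihilates exactly the latter.
\<close>

lemma range_projection_exists:
  fixes A :: "real^'n^'q"
  obtains P where "linear P" "\<And>y z. P y \<bullet> z = y \<bullet> P z" "\<And>y. P (P y) = P y"
    "\<And>x. P (A *v x) = A *v x" "\<And>z. transpose A *v P z = transpose A *v z"
    "\<And>z. P z = 0 \<longleftrightarrow> transpose A *v z = 0" "\<And>z. P z \<in> range (\<lambda>x. A *v x)"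
proof -
  let ?S = "range (\<lambda>x. A *v x)"
  have "subspace ?S" by (intro linear_subspace_image) auto
  then obtain P where P: "linear P" "\<And>y z. P y \<bullet> z = y \<bullet> P z" "\<And>y. P y \<in> ?S" "\<And>y. y \<in> ?S \<Longrightarrow> P y = y"
    using orthogonal_projection_exists by blast
  have T: "transpose A *v P z = transpose A *v z" for z
  proof -
    have "(transpose A *v P z) \<bullet> x = (transpose A *v z) \<bullet> x" for x
      using P(2)[of z "A *v x"] P(4)[of "A *v x"] by (simp add: transpose_inner del: transpose_matrix_vector)
    then show ?thesis using vector_eq_rdot by blast
  qed
  have Z: "P z = 0 \<longleftrightarrow> transpose A *v z = 0" for z
  proof
    assume "P z = 0" then show "transpose A *v z = 0" using T[of z] by simp
  next
    assume z: "transpose A *v z = 0"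
    obtain x where "P z = A *v x" using P(3) by blast
    then have "P z \<bullet> P z = (transpose A *v P z) \<bullet> x" by (simp add: transpose_inner del: transpose_matrix_vector)
    then show "P z = 0" using T[of z] z by simp
  qed
  show thesis
  proof (rule that[of P])
    show "P (P y) = P y" for y by (rule P(4)[OF P(3)])
    show "P (A *v x) = A *v x" for x by (rule P(4)) simp
  qed (rule P(1,2,3) T Z)+
qed

text \<open>
  If \<open>A\<^sup>T A x = 0\<close> then \<open>\<bar>A x\<bar>\<^sup>2 = A\<^sup>T A x \<bullet> x = 0\<close>; an injective linear map on a finite-dimensional
  space is bounded below.
\<close>

lemma transpose_bounded_below_on_range:
  fixes A :: "real^'n^'q"
  obtains \<sigma> where "\<sigma> > 0" "\<And>x. \<sigma> * norm (A *v x) \<le> norm (transpose A *v (A *v x))"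
proof -
  let ?S = "range (\<lambda>x. A *v x)"
  have sub: "subspace ?S" by (intro linear_subspace_image) auto
  have "\<exists>e>0. \<forall>y\<in>?S. norm (transpose A *v y) \<ge> e * norm y"
  proof (rule injective_imp_isometric[OF closed_subspace[OF sub] sub])
    show "\<forall>y\<in>?S. transpose A *v y = 0 \<longrightarrow> y = 0"
    proof clarify
      fix x assume "transpose A *v (A *v x) = 0"
      then have "(A *v x) \<bullet> (A *v x) = 0"
        using transpose_inner[of A "A *v x" x] by simp
      then show "A *v x = 0" by simp
    qed
  qed (rule matrix_vector_mul_bounded_linear)
  then show thesis using that by blast
qed

section \<open>Saddle points as equilibria\<close>

lemma saddle_dynamics_bilinear_coupling:
  fixes f :: "real^'n \<Rightarrow> real" and A :: "real^'n^'q"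
  assumes F: "\<And>x z. F x z = f x + z \<bullet> (A *v x - b)"
    and f: "\<And>x. GDERIV f x :> G x"
  shows "saddle_dynamics F (x, z) v = (- (G x + transpose A *v z), A *v x - b) + v"
proof -
  have "GDERIV (\<lambda>x. F x z) x :> G x + transpose A *v z"
  proof -
    have "((\<lambda>x. z \<bullet> (A *v x - b)) has_derivative (\<lambda>h. z \<bullet> (A *v h))) (at x)"
      by (auto intro!: derivative_eq_intros bounded_linear.has_derivative[OF matrix_vector_mul_bounded_linear])
    then have "GDERIV (\<lambda>x. z \<bullet> (A *v x - b)) x :> transpose A *v z"
      unfolding gderiv_def 
      by (simp add: inner_commute[of _ "transpose A *v z"] transpose_inner del: transpose_matrix_vector)
    then show ?thesis unfolding F by (rule GDERIV_add[OF f])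
  qed
  moreover have "GDERIV (\<lambda>z. F x z) z :> A *v x - b"
    unfolding gderiv_def F by (auto intro!: derivative_eq_intros)
  ultimately show ?thesis by (simp add: saddle_dynamics_def gradient_eqI)
qed

text \<open>
  The payoff is affine in \<open>z\<close>, so a maximum in \<open>z\<close> forces \<open>A x = b\<close>; it is convex in \<open>x\<close>, so a
  minimum in \<open>x\<close> is the same as a critical point.
\<close>

lemma Saddle_bilinear_coupling:
  fixes f :: "real^'n \<Rightarrow> real" and A :: "real^'n^'q"
  assumes F: "\<And>x z. F x z = f x + z \<bullet> (A *v x - b)"
    and f: "\<And>x. GDERIV f x :> G x"
    and mono: "\<And>x y. 0 \<le> (G x - G y) \<bullet> (x - y)"
  shows "(x, z) \<in> Saddle F \<longleftrightarrow> G x + transpose A *v z = 0 \<and> A *v x = b"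
proof
  assume saddle: "(x, z) \<in> Saddle F"
  have "F x (z + (A *v x - b)) \<le> F x z" using saddle by (simp add: Saddle_def)
  then have "(A *v x - b) \<bullet> (A *v x - b) \<le> 0" by (simp add: F inner_add_left)
  then have "A *v x = b" by (metis eq_iff_diff_eq_0 inner_eq_zero_iff inner_ge_zero order_antisym)
  moreover have "G x + transpose A *v z = 0"
  proof -
    have "((\<lambda>x. z \<bullet> (A *v x - b)) has_derivative (\<lambda>h. z \<bullet> (A *v h))) (at x)"
      by (auto intro!: derivative_eq_intros bounded_linear.has_derivative[OF matrix_vector_mul_bounded_linear])
    then have "((\<lambda>x. F x z) has_derivative (\<lambda>h. h \<bullet> G x + z \<bullet> (A *v h))) (at x)"
      unfolding F using f[of x, unfolded gderiv_def] by (intro has_derivative_add)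
    moreover have "\<forall>y\<in>UNIV. F x z \<le> F y z" using saddle by (simp add: Saddle_def)
    ultimately have "(\<lambda>h. h \<bullet> G x + z \<bullet> (A *v h)) = (\<lambda>h. 0)"
      using differential_zero_maxmin[of x UNIV "\<lambda>x. F x z"] by auto
    then have "(G x + transpose A *v z) \<bullet> h = 0" for h
      by (simp add: inner_add_left transpose_inner inner_commute[of "G x"] fun_eq_iff del: transpose_matrix_vector)
    then show ?thesis using vector_eq_rdot[of "G x + transpose A *v z" 0] by auto
  qed
  ultimately show "G x + transpose A *v z = 0 \<and> A *v x = b" by simp
next
  assume *: "G x + transpose A *v z = 0 \<and> A *v x = b"
  then have Gx: "G x = - (transpose A *v z)" by (metis eq_neg_iff_add_eq_0)
  have "F x z \<le> F y z" for y
  proof -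
    have "f x + G x \<bullet> (y - x) \<le> f y" by (rule gradient_inequality[OF f mono])
    then show ?thesis using *
      by (simp add: F Gx transpose_inner inner_diff_right matrix_vector_mult_diff_distrib del: transpose_matrix_vector)
  qed
  then show "(x, z) \<in> Saddle F" using * by (simp add: Saddle_def F)
qed

text \<open>
  The nearest point is \<open>(x0, z - P (z - z0))\<close>; no point of the set is closer, because \<open>P\<close> is a
  contraction that forgets the kernel.
\<close>

lemma infdist_kernel_translate:
  fixes x x0 :: "'a::euclidean_space" and z z0 :: "'b::euclidean_space"
  assumes P: "linear P" "\<And>y z. P y \<bullet> z = y \<bullet> P z" "\<And>y. P (P y) = P y"
  shows "(infdist (x, z) {(x0, z) | z. P (z - z0) = 0})\<^sup>2 = (norm (x - x0))\<^sup>2 + (norm (P (z - z0)))\<^sup>2"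
proof -
  let ?S = "{(x0, z) | z. P (z - z0) = 0}"
  let ?r = "sqrt ((norm (x - x0))\<^sup>2 + (norm (P (z - z0)))\<^sup>2)"
  have "infdist (x, z) ?S = ?r"
  proof (rule antisym)
    have "(x0, z - P (z - z0)) \<in> ?S"
      using P(3)[of "z - z0"] linear_diff[OF P(1), of "z - z0" "P (z - z0)"]
      by (auto simp: algebra_simps intro!: exI[of _ "z - P (z - z0)"])
    from infdist_le[OF this, of "(x, z)"] show "infdist (x, z) ?S \<le> ?r"
      unfolding dist_Pair_Pair by (simp add: dist_norm)
  next
    have "?r \<le> dist (x, z) s" if sS: "s \<in> ?S" for s
    proof -
      obtain k where k: "s = (x0, k)" "P (k - z0) = 0" using sS by blast
      have Pk: "P (z - z0) = P (z - k)"
        using k(2) linear_add[OF P(1), of "z - k" "k - z0"] by simp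
      have "(norm (P (z - k)))\<^sup>2 = (z - k) \<bullet> P (z - k)"
        unfolding power2_norm_eq_inner P(2)[of "z - k" "P (z - k)"] P(3) ..
      also have "\<dots> \<le> norm (z - k) * norm (P (z - k))" by (rule norm_cauchy_schwarz)
      finally have "norm (P (z - k)) \<le> norm (z - k)"
        by (cases "P (z - k) = 0") (simp_all add: power2_eq_square)
      then show ?thesis unfolding k(1) Pk dist_Pair_Pair
        by (simp add: dist_norm power_mono)
    qed
    moreover have "?S \<noteq> {}" using linear_0[OF P(1)] by (auto intro: exI[of _ z0])
    ultimately show "?r \<le> infdist (x, z) ?S"
      unfolding infdist_notempty[OF \<open>?S \<noteq> {}\<close>] by (intro cINF_greatest) auto
  qed
  then show ?thesis by simp
qed

section \<open>The Lyapunov function of the saddle-point dynamics\<close>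

lemma young_inequality:
  fixes a b k :: real
  assumes "k > 0"
  shows "a * b \<le> k / 4 * a\<^sup>2 + b\<^sup>2 / k"
proof -
  have "0 \<le> (k * a / 2 - b)\<^sup>2 / k" using assms by simp
  also have "\<dots> = k / 4 * a\<^sup>2 + b\<^sup>2 / k - a * b"
    using assms by (simp add: power2_eq_square field_simps)
  finally show ?thesis by simp
qed

text \<open>
  The derivative of the Lyapunov function after the Cauchy-Schwarz inequality, with
  \<open>a = \<bar>\<xi>\<bar>\<close>, \<open>y = \<bar>P \<zeta>\<bar>\<close>, \<open>p = \<bar>A\<^sup>T \<zeta>\<bar>\<close>, \<open>v = \<bar>u\<bar>\<close> and \<open>N\<close> a bound for the norm of \<open>A\<close>. Young's
  inequality absorbs the mixed products into \<open>- m a\<^sup>2\<close> and \<open>- \<epsilon> p\<^sup>2\<close>; the products that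
  carry \<open>\<epsilon>\<close> cost a multiple of \<open>\<epsilon> a\<^sup>2\<close>, which is why a small \<open>\<epsilon>\<close> suffices.
\<close>

lemma dissipation_estimate:
  fixes a y p v :: real
  assumes nonneg: "0 \<le> y" "0 < \<epsilon>" "0 < m" "0 < \<sigma>"
    and p: "\<sigma> * y \<le> p"
    and \<epsilon>: "\<epsilon> * (2 * N\<^sup>2 + M\<^sup>2) \<le> m / 4"
  shows "- m * a\<^sup>2 + a * v + y * v + \<epsilon> * (p * (M * a) - p\<^sup>2 + p * v + (N * a)\<^sup>2 + v * (N * a))
    \<le> - min (m / 2) (\<epsilon> * \<sigma>\<^sup>2 / 4) * (a\<^sup>2 + y\<^sup>2) + (2 * \<epsilon> + 1 / m + 1 / (\<epsilon> * \<sigma>\<^sup>2)) * v\<^sup>2"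
proof -
  have "\<epsilon> * (p * (M * a) - p\<^sup>2 + p * v + (N * a)\<^sup>2 + v * (N * a))
      \<le> \<epsilon> * ((2 * N\<^sup>2 + M\<^sup>2) * a\<^sup>2 - p\<^sup>2 / 2 + 2 * v\<^sup>2)"
  proof (rule mult_left_mono)
    have "p * (M * a) \<le> p\<^sup>2 / 4 + (M * a)\<^sup>2" "p * v \<le> p\<^sup>2 / 4 + v\<^sup>2"
      "v * (N * a) \<le> v\<^sup>2 + (N * a)\<^sup>2"
      using young_inequality[of 1 p "M * a"] young_inequality[of 1 p v] young_inequality[of 4 v "N * a"]
      by (auto intro: order_trans)
    then show "p * (M * a) - p\<^sup>2 + p * v + (N * a)\<^sup>2 + v * (N * a)
        \<le> (2 * N\<^sup>2 + M\<^sup>2) * a\<^sup>2 - p\<^sup>2 / 2 + 2 * v\<^sup>2"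
      by (simp add: power_mult_distrib algebra_simps)
  qed (use nonneg in simp)
  also have "\<dots> = \<epsilon> * (2 * N\<^sup>2 + M\<^sup>2) * a\<^sup>2 - \<epsilon> / 2 * p\<^sup>2 + 2 * \<epsilon> * v\<^sup>2"
    by (simp add: algebra_simps)
  also have "\<dots> \<le> m / 4 * a\<^sup>2 - \<epsilon> / 2 * (\<sigma> * y)\<^sup>2 + 2 * \<epsilon> * v\<^sup>2"
    using \<epsilon> power_mono[OF p, of 2] nonneg
    by (intro add_mono diff_mono mult_right_mono mult_left_mono) auto
  finally have cross: "\<epsilon> * (p * (M * a) - p\<^sup>2 + p * v + (N * a)\<^sup>2 + v * (N * a))
      \<le> m / 4 * a\<^sup>2 - \<epsilon> * \<sigma>\<^sup>2 / 2 * y\<^sup>2 + 2 * \<epsilon> * v\<^sup>2"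
    by (simp add: power_mult_distrib mult.assoc)
  have av: "a * v \<le> m / 4 * a\<^sup>2 + v\<^sup>2 / m" by (rule young_inequality) fact
  have yv: "y * v \<le> \<epsilon> * \<sigma>\<^sup>2 / 4 * y\<^sup>2 + v\<^sup>2 / (\<epsilon> * \<sigma>\<^sup>2)" using nonneg by (intro young_inequality) simp
  have "min (m / 2) (\<epsilon> * \<sigma>\<^sup>2 / 4) * (a\<^sup>2 + y\<^sup>2) \<le> m / 2 * a\<^sup>2 + \<epsilon> * \<sigma>\<^sup>2 / 4 * y\<^sup>2"
    unfolding distrib_left by (intro add_mono mult_right_mono) auto
  moreover have "(2 * \<epsilon> + 1 / m + 1 / (\<epsilon> * \<sigma>\<^sup>2)) * v\<^sup>2 = 2 * \<epsilon> * v\<^sup>2 + v\<^sup>2 / m + v\<^sup>2 / (\<epsilon> * \<sigma>\<^sup>2)"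
    by (simp add: distrib_right)
  moreover have "m / 4 * a\<^sup>2 + m / 4 * a\<^sup>2 = m / 2 * a\<^sup>2"
    "\<epsilon> * \<sigma>\<^sup>2 / 4 * y\<^sup>2 + \<epsilon> * \<sigma>\<^sup>2 / 4 * y\<^sup>2 = \<epsilon> * \<sigma>\<^sup>2 / 2 * y\<^sup>2" by simp_all
  ultimately show ?thesis using cross av yv by linarith
qed

text \<open>
  Strong monotonicity of the gradient provides the dissipation in \<open>\<xi>\<close>; its Lipschitz bound and
  the boundedness below of \<open>A\<^sup>T\<close> on the range of \<open>A\<close> make the cross term provide that in \<open>\<zeta>\<close>.
\<close>

theorem ISS_wrt_saddle_dynamics:
  fixes F :: "real^'n \<Rightarrow> real^'q \<Rightarrow> real" and f :: "real^'n \<Rightarrow> real" and A :: "real^'n^'q"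
  assumes F: "\<And>x z. F x z = f x + z \<bullet> (A *v x - b)"
    and f: "\<And>x. GDERIV f x :> G x"
    and "m > 0" and lower: "\<And>x y. m * (norm (x - y))\<^sup>2 \<le> (G x - G y) \<bullet> (x - y)"
    and Lip: "\<And>x y. norm (G x - G y) \<le> M * norm (x - y)"
    and "Saddle F \<noteq> {}"
  shows "ISS_wrt (saddle_dynamics F) (Saddle F)"
proof -
  have mono: "0 \<le> (G x - G y) \<bullet> (x - y)" for x y
    using lower[of x y] \<open>m > 0\<close> by (meson less_imp_le mult_nonneg_nonneg order_trans zero_le_power2)
  note dyn = saddle_dynamics_bilinear_coupling[OF F f]
  note saddle = Saddle_bilinear_coupling[OF F f mono]
  obtain x0 z0 where eq: "G x0 + transpose A *v z0 = 0" "A *v x0 = b"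
    using \<open>Saddle F \<noteq> {}\<close> saddle by (metis ex_in_conv surj_pair)
  obtain P where P: "linear P" "\<And>y z. P y \<bullet> z = y \<bullet> P z" "\<And>y. P (P y) = P y"
    "\<And>x. P (A *v x) = A *v x" "\<And>z. transpose A *v P z = transpose A *v z"
    "\<And>z. P z = 0 \<longleftrightarrow> transpose A *v z = 0" "\<And>z. P z \<in> range (\<lambda>x. A *v x)"
    by (rule range_projection_exists[of A]) (rule that)
  obtain \<sigma> where \<sigma>: "\<sigma> > 0" "\<And>x. \<sigma> * norm (A *v x) \<le> norm (transpose A *v (A *v x))"
    using transpose_bounded_below_on_range by blast
  have \<sigma>P: "\<sigma> * norm (P z) \<le> norm (transpose A *v z)" for z
  proof -
    obtain x where "P z = A *v x" using P(7)[of z] by blast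
    then show ?thesis using \<sigma>(2)[of x] P(5)[of z] by simp
  qed
  obtain N where N: "N > 0" "\<And>x. norm (A *v x) \<le> N * norm x"
    using bounded_linear.pos_bounded[OF matrix_vector_mul_bounded_linear[of A]] by (metis mult.commute)
  \<comment> \<open>The first bound serves \<open>dissipation_estimate\<close>; the second keeps the cross term below half
     of the leading part of the Lyapunov function.\<close>
  define \<epsilon> where "\<epsilon> = min (m / (4 * (2 * N\<^sup>2 + M\<^sup>2))) (1 / (2 * N))"
  have pos: "2 * N\<^sup>2 + M\<^sup>2 > 0" using N(1) by (simp add: add_pos_nonneg)
  have \<epsilon>: "\<epsilon> > 0" "\<epsilon> * (2 * N\<^sup>2 + M\<^sup>2) \<le> m / 4" "\<epsilon> * N \<le> 1 / 2"
  proof -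
    show "\<epsilon> > 0" using pos N(1) \<open>m > 0\<close> by (simp add: \<epsilon>_def)
    have "\<epsilon> \<le> m / (4 * (2 * N\<^sup>2 + M\<^sup>2))" "\<epsilon> \<le> 1 / (2 * N)" by (simp_all add: \<epsilon>_def)
    then show "\<epsilon> * (2 * N\<^sup>2 + M\<^sup>2) \<le> m / 4" "\<epsilon> * N \<le> 1 / 2"
      using pos N(1) by (simp_all add: field_simps)
  qed
  define \<kappa> where "\<kappa> = min (m / 2) (\<epsilon> * \<sigma>\<^sup>2 / 4)"
  define d where "d = 2 * \<epsilon> + 1 / m + 1 / (\<epsilon> * \<sigma>\<^sup>2)"
  have \<kappa>d: "\<kappa> > 0" "d > 0" using \<epsilon>(1) \<open>m > 0\<close> \<sigma>(1) by (auto simp: \<kappa>_def d_def intro!: add_pos_pos)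

  have S: "Saddle F = {(x0, z) | z. P (z - z0) = 0}"
  proof -
    have "(x, z) \<in> Saddle F \<longleftrightarrow> x = x0 \<and> P (z - z0) = 0" for x z
    proof
      assume "(x, z) \<in> Saddle F"
      then have xz: "G x + transpose A *v z = 0" "A *v x = b" using saddle by auto
      have "G x = - (transpose A *v z)" "G x0 = - (transpose A *v z0)"
        using xz(1) eq(1) by (metis eq_neg_iff_add_eq_0)+
      then have diff: "G x - G x0 = - (transpose A *v (z - z0))"
        by (simp add: matrix_vector_mult_diff_distrib del: transpose_matrix_vector)
      have "(G x - G x0) \<bullet> (x - x0) = - ((z - z0) \<bullet> (A *v x - A *v x0))"
        unfolding diff inner_minus_left transpose_inner by (simp only: matrix_vector_mult_diff_distrib)
      then have "(G x - G x0) \<bullet> (x - x0) = 0" using xz(2) eq(2) by simp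
      with lower[of x x0] \<open>m > 0\<close> have "x = x0" by (simp add: mult_le_0_iff)
      moreover from this have "transpose A *v (z - z0) = 0" using diff by simp
      ultimately show "x = x0 \<and> P (z - z0) = 0" using P(6) by blast
    next
      assume "x = x0 \<and> P (z - z0) = 0"
      then show "(x, z) \<in> Saddle F"
        using eq P(6)[of "z - z0"] by (simp add: saddle matrix_vector_mult_diff_distrib del: transpose_matrix_vector)
    qed
    then show ?thesis by auto
  qed
  \<comment> \<open>half the squared distance to the saddle set, plus the cross term that makes \<open>\<zeta>\<close> dissipate\<close>
  define B where "B = (\<lambda>w w'. (fst w \<bullet> fst w' + P (snd w) \<bullet> P (snd w')) / 2 + \<epsilon> * (snd w \<bullet> (A *v fst w')))"
  have "bilinear B"
    unfolding bilinear_def B_def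
    by (intro conjI allI linearI)
      (simp_all add: linear_add[OF P(1)] linear_cmul[OF P(1)] inner_add_left inner_add_right
        matrix_vector_right_distrib matrix_vector_mult_scaleR field_simps)
  then have B: "bounded_bilinear B" by (simp add: bilinear_conv_bounded_bilinear)
  have cross: "\<bar>\<epsilon> * (\<zeta> \<bullet> (A *v \<xi>))\<bar> \<le> ((norm \<xi>)\<^sup>2 + (norm (P \<zeta>))\<^sup>2) / 4" for \<xi> \<zeta>
  proof -
    have "\<bar>\<zeta> \<bullet> (A *v \<xi>)\<bar> = \<bar>P \<zeta> \<bullet> (A *v \<xi>)\<bar>" by (simp add: P(2,4))
    also have "\<dots> \<le> norm (P \<zeta>) * (N * norm \<xi>)"
      by (rule order_trans[OF Cauchy_Schwarz_ineq2]) (intro mult_left_mono N(2) norm_ge_zero)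
    finally have "\<bar>\<epsilon> * (\<zeta> \<bullet> (A *v \<xi>))\<bar> \<le> \<epsilon> * (norm (P \<zeta>) * (N * norm \<xi>))"
      using \<epsilon>(1) by (simp add: abs_mult)
    also have "\<dots> = (\<epsilon> * N) * (norm \<xi> * norm (P \<zeta>))" by simp
    also have "\<dots> \<le> 1 / 2 * (norm \<xi> * norm (P \<zeta>))" using \<epsilon>(3) by (intro mult_right_mono) auto
    also have "\<dots> \<le> ((norm \<xi>)\<^sup>2 + (norm (P \<zeta>))\<^sup>2) / 4"
      using sum_squares_bound[of "norm \<xi>" "norm (P \<zeta>)"] by simp
    finally show ?thesis .
  qed
  have dist: "(infdist w (Saddle F))\<^sup>2 = (norm (fst w - x0))\<^sup>2 + (norm (P (snd w - z0)))\<^sup>2" for w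
    unfolding S using infdist_kernel_translate[OF P(1-3), of "fst w" "snd w" x0 z0] by simp
  have BV: "B (w - (x0, z0)) (w - (x0, z0)) = (infdist w (Saddle F))\<^sup>2 / 2
      + \<epsilon> * ((snd w - z0) \<bullet> (A *v (fst w - x0)))" for w
    by (simp add: B_def dist power2_norm_eq_inner)
  show ?thesis
  proof (rule ISS_wrt_if_quadratic_Lyapunov[OF _ B \<kappa>d(1) _ _ \<kappa>d(2), where e = "(x0, z0)" and c = "1 / 4" and C = 1])
    show "Saddle F = unforced_equilibria (saddle_dynamics F)"
    proof (rule set_eqI)
      fix w :: "(real^'n) \<times> (real^'q)"
      obtain x z where w: "w = (x, z)" by fastforce
      have "saddle_dynamics F w 0 = 0 \<longleftrightarrow> G x + transpose A *v z = 0 \<and> A *v x = b"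
        unfolding w dyn by (simp only: zero_prod_def add_Pair add_0_right prod.inject neg_equal_0_iff_equal eq_iff_diff_eq_0[symmetric])
      then show "w \<in> Saddle F \<longleftrightarrow> w \<in> unforced_equilibria (saddle_dynamics F)"
        by (simp only: w saddle unforced_equilibria_def mem_Collect_eq)
    qed
    show "1 / 4 * (infdist w (Saddle F))\<^sup>2 \<le> B (w - (x0, z0)) (w - (x0, z0))" for w
      using cross[of "snd w - z0" "fst w - x0"] unfolding BV dist by linarith
    show upper: "B (w - (x0, z0)) (w - (x0, z0)) \<le> 1 * (infdist w (Saddle F))\<^sup>2" for w
    proof -
      have "0 \<le> (infdist w (Saddle F))\<^sup>2" by simp
      then show ?thesis
        using cross[of "snd w - z0" "fst w - x0"] unfolding BV dist by linarith
    qed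
    fix w v :: "(real^'n) \<times> (real^'q)"
    obtain x z where w: "w = (x, z)" by fastforce
    obtain vx vz where v: "v = (vx, vz)" by fastforce
    define \<xi> \<zeta> g q where "\<xi> = x - x0" and "\<zeta> = z - z0" and "g = G x - G x0" and "q = transpose A *v \<zeta>"
    define a y p U where "a = norm \<xi>" and "y = norm (P \<zeta>)" and "p = norm q" and "U = norm v"
    have qi: "q \<bullet> h = \<zeta> \<bullet> (A *v h)" for h unfolding q_def by (rule transpose_inner)
    have field: "saddle_dynamics F w v = (vx - g - q, A *v \<xi> + vz)"
      using eq by (simp add: w v dyn g_def q_def \<xi>_def \<zeta>_def matrix_vector_mult_diff_distrib
          eq_neg_iff_add_eq_0[symmetric] algebra_simps del: transpose_matrix_vector)
    have U: "norm vx \<le> U" "norm vz \<le> U"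
      by (simp_all add: U_def v norm_fst_le norm_snd_le)
    have "B (w - (x0, z0)) (saddle_dynamics F w v) + B (saddle_dynamics F w v) (w - (x0, z0))
        = \<xi> \<bullet> (vx - g - q) + P \<zeta> \<bullet> P (A *v \<xi> + vz)
          + \<epsilon> * (\<zeta> \<bullet> (A *v (vx - g - q)) + (A *v \<xi> + vz) \<bullet> (A *v \<xi>))"
      unfolding field by (simp add: B_def w \<xi>_def[symmetric] \<zeta>_def[symmetric] inner_commute field_simps)
    \<comment> \<open>The term \<open>q \<bullet> \<xi>\<close> produced here cancels against the one from \<open>\<xi> \<bullet> (vx - g - q)\<close>.\<close>
    also have "P \<zeta> \<bullet> P (A *v \<xi> + vz) = q \<bullet> \<xi> + P \<zeta> \<bullet> vz"
      by (simp add: P(1,2,3,4) qi linear_add[OF P(1)] inner_add_right)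
    also have "\<zeta> \<bullet> (A *v (vx - g - q)) = q \<bullet> (vx - g - q)" by (simp add: qi)
    also have "\<xi> \<bullet> (vx - g - q) + (q \<bullet> \<xi> + P \<zeta> \<bullet> vz) + \<epsilon> * (q \<bullet> (vx - g - q) + (A *v \<xi> + vz) \<bullet> (A *v \<xi>))
        = - (g \<bullet> \<xi>) + \<xi> \<bullet> vx + P \<zeta> \<bullet> vz
          + \<epsilon> * (- (q \<bullet> g) - p\<^sup>2 + q \<bullet> vx + (norm (A *v \<xi>))\<^sup>2 + vz \<bullet> (A *v \<xi>))"
      by (simp add: p_def power2_norm_eq_inner inner_diff_left inner_diff_right inner_add_left inner_commute algebra_simps)
    also have "\<dots> \<le> - (m * a\<^sup>2) + a * U + y * U
          + \<epsilon> * (p * (M * a) - p\<^sup>2 + p * U + (N * a)\<^sup>2 + U * (N * a))"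
    proof (intro add_mono mult_left_mono diff_mono)
      show "- (g \<bullet> \<xi>) \<le> - (m * a\<^sup>2)" using lower[of x x0] by (simp add: g_def \<xi>_def a_def)
      have CS: "h \<bullet> k \<le> norm h * c" if "norm k \<le> c" for h k :: "real^'k" and c
        using norm_cauchy_schwarz[of h k] mult_left_mono[OF that norm_ge_zero[of h]] by linarith
      show "\<xi> \<bullet> vx \<le> a * U" "q \<bullet> vx \<le> p * U"
        unfolding a_def p_def by (intro CS U)+
      show "P \<zeta> \<bullet> vz \<le> y * U" unfolding y_def by (intro CS U)
      show "- (q \<bullet> g) \<le> p * (M * a)"
      proof -
        have "norm (- g) \<le> M * a" using Lip[of x x0] unfolding g_def a_def \<xi>_def norm_minus_cancel .
        from CS[OF this, of q] show ?thesis by (simp add: p_def)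
      qed
      show "(norm (A *v \<xi>))\<^sup>2 \<le> (N * a)\<^sup>2" using N(2)[of \<xi>] by (simp add: a_def power_mono)
      have "vz \<bullet> (A *v \<xi>) \<le> norm vz * (N * a)" using N(2) by (intro CS) (simp add: a_def)
      also have "\<dots> \<le> U * (N * a)" using U N(1) by (intro mult_right_mono) (auto simp: a_def)
      finally show "vz \<bullet> (A *v \<xi>) \<le> U * (N * a)" .
    qed (use \<epsilon>(1) in auto)
    also have "\<dots> \<le> - \<kappa> * (a\<^sup>2 + y\<^sup>2) + d * U\<^sup>2"
      unfolding \<kappa>_def d_def
      using dissipation_estimate[of y \<epsilon> m \<sigma> p N M a U] \<epsilon> \<open>m > 0\<close> \<sigma>(1) \<sigma>P[of \<zeta>]
      by (simp add: y_def p_def q_def del: transpose_matrix_vector)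
    also have "\<dots> \<le> - \<kappa> * B (w - (x0, z0)) (w - (x0, z0)) + d * U\<^sup>2"
    proof -
      have "B (w - (x0, z0)) (w - (x0, z0)) \<le> a\<^sup>2 + y\<^sup>2"
        using upper[of w] unfolding dist by (simp add: a_def y_def \<xi>_def \<zeta>_def w)
      then show ?thesis using \<kappa>d(1) by simp
    qed
    finally show "B (w - (x0, z0)) (saddle_dynamics F w v) + B (saddle_dynamics F w v) (w - (x0, z0))
        \<le> - \<kappa> * B (w - (x0, z0)) (w - (x0, z0)) + d * (norm v)\<^sup>2"
      by (simp add: U_def)
  qed auto
qed

theorem theorem6p1:
  fixes F :: "real^'n \<Rightarrow> real^'q \<Rightarrow> real"
    and f :: "real^'n \<Rightarrow> real"
    and A :: "real^'n^'q"
    and b :: "real^'q"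
    and m M :: real
  assumes "\<And>x z. F x z = f x + z \<bullet> (A *v x - b)"
    and "strongly_convex f"
    and "twice_continuously_differentiable f"
    and "0 < m" and "m \<le> M"
    and "\<And>x. mat m \<preceq>\<^sub>L hessian f x"
    and "\<And>x. hessian f x \<preceq>\<^sub>L mat M"
    and "Saddle F \<noteq> {}"
  shows "ISS_wrt (saddle_dynamics F) (Saddle F)"
proof -
  let ?G = "gradient f"
  have f: "GDERIV f x :> ?G x" for x
  proof -
    obtain f' where f': "(f has_derivative f') (at x)"
      using assms(3) unfolding twice_continuously_differentiable_def differentiable_def by blast
    then have "linear f'" by (rule has_derivative_linear)
    then have "f' = (\<lambda>h. h \<bullet> adjoint f' 1)"
      by (simp add: adjoint_works fun_eq_iff)
    with f' have "GDERIV f x :> adjoint f' 1" by (simp add: gderiv_def)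
    then show ?thesis by (simp add: gradient_eqI)
  qed
  have G: "(?G has_derivative (\<lambda>h. hessian f x *v h)) (at x)" for x
    using assms(3) jacobian_works[of ?G "at x"]
    by (simp add: twice_continuously_differentiable_def hessian_def)
  have mat: "v \<bullet> (mat c *v v) = c * (norm v)\<^sup>2" for c and v :: "real^'n"
    by (simp add: power2_norm_eq_inner inner_vec_def matrix_vector_mult_def mat_def
        if_distrib if_distribR sum_distrib_left algebra_simps cong: if_cong)
  have H: "m * (norm h)\<^sup>2 \<le> h \<bullet> (hessian f x *v h)" "h \<bullet> (hessian f x *v h) \<le> M * (norm h)\<^sup>2" for x h
    using assms(6)[of x] assms(7)[of x]
    by (auto simp: loewner_le_def positive_semidefinite_def matrix_vector_mult_diff_rdistrib inner_diff_right mat)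
  have lower: "m * (norm (x - y))\<^sup>2 \<le> (?G x - ?G y) \<bullet> (x - y)" for x y
    by (rule strongly_monotone_if_derivative_ge[OF G H(1)])
  \<comment> \<open>the upper Hessian bound is a lower bound for the derivative of \<open>- \<nabla>f\<close>\<close>
  have neg: "- M * (norm (x - y))\<^sup>2 \<le> (- ?G x - - ?G y) \<bullet> (x - y)" for x y
    using H(2) by (intro strongly_monotone_if_derivative_ge[OF has_derivative_minus[OF G]]) simp
  have upper: "(?G x - ?G y) \<bullet> (x - y) \<le> M * (norm (x - y))\<^sup>2" for x y
    using neg[of x y]
    by (simp add: inner_diff_left)
  have "0 \<le> (?G x - ?G y) \<bullet> (x - y)" for x y
    using lower[of x y] \<open>0 < m\<close> by (meson less_imp_le mult_nonneg_nonneg order_trans zero_le_power2)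
  then have Lip: "norm (?G x - ?G y) \<le> M * norm (x - y)" for x y
    using assms(4,5) by (intro norm_gradient_diff_le[OF f _ upper]) auto
  show ?thesis by (rule ISS_wrt_saddle_dynamics[OF assms(1) f assms(4) lower Lip assms(8)])
qed

end
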